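(* Let $\boldsymbol\alpha=(\alpha_1,\dots,\alpha_d)$, $\boldsymbol\beta=(\beta_1,\dots,\beta_d)$ be multisets of rational numbers, disjoint modulo $\mathbb{Z}$, with common denominator $N$, and let $q$ be a prime power with $(q-1)\alpha_i,(q-1)\beta_j\in\mathbb{Z}$. Define $$\lambda=-\min_{x\in[0,1],\ \gcd(k,N)=1}\Lambda(k\boldsymbol\alpha,k\boldsymbol\beta,x),\qquad \Lambda(\boldsymbol\alpha,\boldsymbol\beta,x)=\sum_{i=1}^d\big(\{x+\alpha_i\}-\{\alpha_i\}+\{-x-\beta_i\}-\{-\beta_i\}\big).$$ Then for every $t\in\mathbb{F}_q^\times$, $q^{\lambda}H_q(\boldsymbol\alpha,\boldsymbol\beta|t)$ is an algebraic integer.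
   Context: $\{x\}$ is the fractional part; $k\boldsymbol\alpha=(k\alpha_1,\dots,k\alpha_d)$. Fix a nontrivial additive character $\psi_q$ of $\mathbb{F}_q$, a generator $\omega$ of the character group of $\mathbb{F}_q^\times$, $g(m)=\sum_{x\in\mathbb{F}_q^\times}\omega(x)^m\psi_q(x)$, $\bar q=q-1$, and $$H_q(\boldsymbol\alpha,\boldsymbol\beta|t)=\frac{1}{1-q}\sum_{m=0}^{q-2}\prod_{i=1}^d\frac{g(m+\alpha_i\bar q)\,g(-m-\beta_i\bar q)}{g(\alpha_i\bar q)\,g(-\beta_i\bar q)}\,\omega((-1)^dt)^m .$$ *)

theory Defs
  imports "HOL-Analysis.Analysis" "HOL-Computational_Algebra.Polynomial"
begin

definition gauss_sum :: "('a::{field,finite} \<Rightarrow> complex) \<Rightarrow> ('a \<Rightarrow> complex) \<Rightarrow> int \<Rightarrow> complex" where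
  "gauss_sum \<omega> \<psi> m = (\<Sum>x\<in>{x::'a. x \<noteq> 0}. (\<omega> x) powi m * \<psi> x)"

text \<open>The integer a*(q-1) for a rational a with (q-1)a integral.\<close>
definition qbar_mult :: "nat \<Rightarrow> rat \<Rightarrow> int" where
  "qbar_mult q a = \<lfloor>a * of_nat (q - 1)\<rfloor>"

definition hypergeom_Hq ::
  "('a::{field,finite} \<Rightarrow> complex) \<Rightarrow> ('a \<Rightarrow> complex) \<Rightarrow> rat list \<Rightarrow> rat list \<Rightarrow> 'a \<Rightarrow> complex" where
  "hypergeom_Hq \<omega> \<psi> alpha beta t =
    (let q = CARD('a); d = length alpha; g = gauss_sum \<omega> \<psi> in
     1 / (1 - of_nat q) *
     (\<Sum>m<q - 1.
        (\<Prod>i<d. g (int m + qbar_mult q (alpha ! i)) * g (- int m - qbar_mult q (beta ! i))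
                 / (g (qbar_mult q (alpha ! i)) * g (- qbar_mult q (beta ! i))))
        * (\<omega> ((-1) ^ d * t)) ^ m))"

definition Lambda_fn :: "rat list \<Rightarrow> rat list \<Rightarrow> real \<Rightarrow> real" where
  "Lambda_fn alpha beta x =
    (\<Sum>i<length alpha. frac (x + real_of_rat (alpha ! i)) - frac (real_of_rat (alpha ! i))
        + frac (- x - real_of_rat (beta ! i)) - frac (- real_of_rat (beta ! i)))"

text \<open>lambda = - min over x in [0,1], gcd(k,N)=1 of Lambda(k alpha, k beta, x).
  (The minimum exists; we use Inf.)\<close>
definition lambda_exp :: "rat list \<Rightarrow> rat list \<Rightarrow> nat \<Rightarrow> real" where
  "lambda_exp alpha beta N =
    - Inf {Lambda_fn (map (\<lambda>a. of_int k * a) alpha) (map (\<lambda>a. of_int k * a) beta) x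
           | k x. coprime k (int N) \<and> x \<in> {0..1}}"

definition common_denom :: "rat list \<Rightarrow> nat" where
  "common_denom xs = Lcm (set (map (\<lambda>a. nat (snd (quotient_of a))) xs))"

end

theory Submission
  imports Defs "HOL-Computational_Algebra.Primes" "HOL-Number_Theory.Cong"
begin

text \<open>
  A complex number lying in every valuation ring \<open>V\<close> of \<open>\<complex>\<close> is an algebraic integer, so it suffices
  to show \<open>q\<^sup>\<lambda> H\<^sub>q \<in> V\<close> for each \<open>V\<close>. If \<open>p\<close> is invertible in \<open>V\<close>, so are all Gauss sums (they divide \<open>q\<close>), and the
  factor \<open>1 / (1 - q)\<close> disappears because \<open>\<Sum>m<q-1. \<omega>(c)\<^sup>m\<close> is \<open>0\<close> or \<open>q - 1\<close>. If \<open>p\<close> lies in the maximal ideal,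
  then \<open>1 - q\<close> is a unit and it suffices to treat each summand. Some power of \<open>\<omega>\<close> with exponent prime to
  \<open>q - 1\<close> is additive modulo the maximal ideal, and Stickelberger's theorem gives, for \<open>q = p\<^sup>f\<close>, that
  \<open>g(a)\<close> equals \<open>(\<zeta>\<^sub>p - 1)\<close> to the power \<open>(p - 1) \<Sum>j<f. {p\<^sup>j k a / (q - 1)}\<close> up to a unit,
  for a fixed \<open>k\<close> prime to \<open>q - 1\<close>. Hence the valuation of the \<open>m\<close>-th summand is an average over \<open>j < f\<close> of values
  \<open>\<Lambda>(p\<^sup>j k \<alpha>, p\<^sup>j k \<beta>, x)\<close>, each of which is at least \<open>- \<lambda>\<close>.
\<close>

section \<open>Valuation rings and algebraic integers\<close>

text \<open>Arbitrary valuation rings of the complex numbers replace the primes of a cyclotomic ring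
  of integers: "valuation \<open>n\<close>" is read as "a unit times \<open>w ^ n\<close>" for a
  fixed \<open>w\<close>, so only divisibility is used and nothing is assumed about the value group.
  The link to integrality is Zorn's lemma: a \<open>z\<close> that is not integral lies outside
  \<open>\<int>[1/z]\<close>, and a maximal subring containing \<open>1/z\<close> and avoiding
  \<open>z\<close> is a valuation ring. Two cases are needed because a single summand need not be
  divisible by \<open>1 - q\<close>: if a prime factor of \<open>q - 1\<close> is a nonunit, only
  the full sum over \<open>m\<close> has the factor \<open>q - 1\<close>. Which power of \<omega> is
  additive modulo the maximal ideal depends on the valuation ring, and Frobenius brings in the
  factors \<open>p ^ j\<close>; this is why \<lambda> has to take all multiples by \<open>k\<close>
  prime to \<open>N\<close> into account. Since \<Lambda> takes integer values, \<lambda> is a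
  natural number, and \<open>q\<close> to the power \<lambda> is again a power of \<open>w\<close>
  up to a unit.\<close>

locale subring_of_field =
  fixes A :: "'b::field set"
  assumes one_mem: "1 \<in> A"
    and diff_mem: "x \<in> A \<Longrightarrow> y \<in> A \<Longrightarrow> x - y \<in> A"
    and mult_mem: "x \<in> A \<Longrightarrow> y \<in> A \<Longrightarrow> x * y \<in> A"
begin

lemma zero_mem: "0 \<in> A"
  using diff_mem[OF one_mem one_mem] by simp

lemma uminus_mem: "x \<in> A \<Longrightarrow> - x \<in> A"
  using diff_mem[OF zero_mem] by simp

lemma add_mem: "x \<in> A \<Longrightarrow> y \<in> A \<Longrightarrow> x + y \<in> A"
  using diff_mem[OF _ uminus_mem, of x y] by simp

lemma sum_mem: "(\<And>i. i \<in> I \<Longrightarrow> h i \<in> A) \<Longrightarrow> sum h I \<in> A"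
  by (induction I rule: infinite_finite_induct) (auto intro: zero_mem add_mem)

lemma prod_mem: "(\<And>i. i \<in> I \<Longrightarrow> h i \<in> A) \<Longrightarrow> prod h I \<in> A"
  by (induction I rule: infinite_finite_induct) (auto intro: one_mem mult_mem)

lemma power_mem: "x \<in> A \<Longrightarrow> x ^ n \<in> A"
  by (induction n) (auto intro: one_mem mult_mem)

lemma of_nat_mem: "of_nat n \<in> A"
  by (induction n) (auto intro: zero_mem one_mem add_mem)

lemma of_int_mem: "of_int n \<in> A"
  by (cases n) (simp_all only: of_int_of_nat_eq of_int_minus of_nat_mem uminus_mem)

definition adjoin :: "'b \<Rightarrow> 'b set" where
  "adjoin y = {poly P y | P. \<forall>i. coeff P i \<in> A}"

text \<open>Unlike \<open>adjoin\<close>, this records the length of a polynomial expression in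
  \<open>y\<close>, so that a shortest one can be chosen.\<close>

definition pow_span :: "nat \<Rightarrow> 'b \<Rightarrow> 'b set" where
  "pow_span n y = {\<Sum>i<n. a i * y ^ i | a. \<forall>i. a i \<in> A}"

lemma subring_adjoin: "subring_of_field (adjoin y)"
proof
  have "1 = poly 1 y" "\<forall>i. coeff 1 i \<in> A"
    by (auto simp: coeff_1 one_mem zero_mem)
  then show "1 \<in> adjoin y" unfolding adjoin_def by blast
next
  fix a b assume "a \<in> adjoin y" "b \<in> adjoin y"
  then obtain P Q where P: "a = poly P y" "\<forall>i. coeff P i \<in> A" and Q: "b = poly Q y" "\<forall>i. coeff Q i \<in> A"
    by (auto simp: adjoin_def)
  have "a - b = poly (P - Q) y" "\<forall>i. coeff (P - Q) i \<in> A"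
    using P Q by (auto intro: diff_mem)
  then show "a - b \<in> adjoin y" unfolding adjoin_def by blast
  have "a * b = poly (P * Q) y" "\<forall>i. coeff (P * Q) i \<in> A"
    using P Q by (auto simp: coeff_mult intro!: sum_mem mult_mem)
  then show "a * b \<in> adjoin y" unfolding adjoin_def by blast
qed

lemma mem_adjoin: "y \<in> adjoin y"
proof -
  have "y = poly [:0, 1:] y" "\<forall>i. coeff [:0, 1:] i \<in> A"
    by (auto simp: coeff_pCons zero_mem one_mem split: nat.split)
  then show ?thesis unfolding adjoin_def by blast
qed

lemma subset_adjoin: "A \<subseteq> adjoin y"
proof
  fix a assume "a \<in> A"
  then have "a = poly [:a:] y" "\<forall>i. coeff [:a:] i \<in> A"
    by (auto simp: coeff_pCons zero_mem split: nat.split)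
  then show "a \<in> adjoin y" unfolding adjoin_def by blast
qed

lemma adjoin_imp_pow_span:
  assumes "a \<in> adjoin y" obtains n where "a \<in> pow_span n y"
proof -
  obtain P where P: "a = poly P y" "\<forall>i. coeff P i \<in> A" using assms by (auto simp: adjoin_def)
  have "a = (\<Sum>i<Suc (degree P). coeff P i * y ^ i)"
    unfolding P(1) poly_altdef by (simp only: lessThan_Suc_atMost)
  then have "a \<in> pow_span (Suc (degree P)) y" using P(2) unfolding pow_span_def by blast
  then show ?thesis using that by blast
qed

lemma pow_span_add:
  assumes "a \<in> pow_span n y" "b \<in> pow_span n y" shows "a + b \<in> pow_span n y"
proof -
  obtain c d where "a = (\<Sum>i<n. c i * y ^ i)" "\<forall>i. c i \<in> A"
    "b = (\<Sum>i<n. d i * y ^ i)" "\<forall>i. d i \<in> A"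
    using assms by (auto simp: pow_span_def)
  then have "a + b = (\<Sum>i<n. (c i + d i) * y ^ i)" "\<forall>i. c i + d i \<in> A"
    by (auto simp: sum.distrib distrib_right intro: add_mem)
  then show ?thesis unfolding pow_span_def by (intro CollectI exI[of _ "\<lambda>i. c i + d i"]) auto
qed

lemma pow_span_monom:
  assumes "a \<in> A" "i < n" shows "a * y ^ i \<in> pow_span n y"
proof -
  let ?c = "\<lambda>j. if j = i then a else 0"
  have "(\<Sum>j<n. ?c j * y ^ j) = (\<Sum>j\<in>{i}. a * y ^ j)"
    using assms by (intro sum.mono_neutral_cong_right) auto
  then have "a * y ^ i = (\<Sum>j<n. ?c j * y ^ j)" by simp
  then show ?thesis
    unfolding pow_span_def using assms zero_mem by (intro CollectI exI[of _ ?c]) auto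
qed

lemma pow_span_zero: "0 \<in> pow_span n y"
  unfolding pow_span_def using zero_mem by (intro CollectI exI[of _ "\<lambda>_. 0"]) auto

lemma pow_span_sum: "(\<And>j. j \<in> J \<Longrightarrow> h j \<in> pow_span n y) \<Longrightarrow> sum h J \<in> pow_span n y"
  by (induction J rule: infinite_finite_induct) (auto intro: pow_span_add pow_span_zero)

end

locale valuation_ring = subring_of_field V for V :: "'b::field set" +
  assumes mem_or_inverse_mem: "x \<in> V \<or> inverse x \<in> V"

text \<open>The object that Zorn's lemma provides. With \<open>inverse z\<close> inside and
  \<open>z\<close> outside, \<open>inverse z\<close> is a nonunit of \<open>A\<close>, and by
  maximality every strictly larger subring contains \<open>z\<close>.\<close>

locale maximal_subring_avoiding = subring_of_field A for A :: "'b::field set" +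
  fixes z :: 'b
  assumes inverse_mem: "inverse z \<in> A" and notin: "z \<notin> A"
    and maximal: "subring_of_field B \<Longrightarrow> A \<subseteq> B \<Longrightarrow> z \<notin> B \<Longrightarrow> B = A"
begin

lemma z_nonzero: "z \<noteq> 0"
  using notin zero_mem by auto

lemma mem_adjoin_of_notin: "y \<notin> A \<Longrightarrow> z \<in> adjoin y"
  using maximal[OF subring_adjoin subset_adjoin] mem_adjoin by blast

text \<open>With \<open>c = 1 - inverse z * b\<close>, the elements \<open>z * c ^ n\<close> and
  \<open>z * c ^ Suc n\<close> differ by \<open>b * c ^ n\<close>, which lies in \<open>A\<close>;
  so membership descends to \<open>z\<close> itself.\<close>

lemma mem_of_mult_power_mem:
  assumes "b \<in> A" "z * (1 - inverse z * b) ^ n \<in> A" shows False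
  using assms(2)
proof (induction n)
  case 0
  then show ?case using notin by simp
next
  case (Suc n)
  have "z * (1 - inverse z * b) ^ n = z * (1 - inverse z * b) ^ Suc n + b * (1 - inverse z * b) ^ n"
    using z_nonzero by (simp add: algebra_simps)
  moreover have "b * (1 - inverse z * b) ^ n \<in> A"
    using assms inverse_mem by (intro mult_mem power_mem diff_mem one_mem)
  ultimately show ?case using Suc add_mem by metis
qed

text \<open>The element \<open>inverse z\<close> lies in the Jacobson radical: otherwise \<open>1 - inverse z * b\<close> could be inverted.\<close>

lemma inverse_one_minus_mem:
  assumes b: "b \<in> A" shows "inverse (1 - inverse z * b) \<in> A" "1 - inverse z * b \<noteq> 0"
proof -
  let ?c = "1 - inverse z * b"
  have cA: "?c \<in> A" using b inverse_mem by (intro diff_mem one_mem mult_mem)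
  show nz: "?c \<noteq> 0" using mem_of_mult_power_mem[OF b, of 1] zero_mem by auto
  show "inverse ?c \<in> A"
  proof (rule ccontr)
    assume "inverse ?c \<notin> A"
    then have "z \<in> adjoin (inverse ?c)" by (rule mem_adjoin_of_notin)
    then obtain n where "z \<in> pow_span n (inverse ?c)" by (rule adjoin_imp_pow_span)
    then obtain a where a: "z = (\<Sum>i<n. a i * inverse ?c ^ i)" "\<forall>i. a i \<in> A"
      unfolding pow_span_def by blast
    \<comment> \<open>Multiplication by \<open>?c ^ n\<close> clears the denominators and puts
      \<open>z * ?c ^ n\<close> into \<open>A\<close>, which \<open>mem_of_mult_power_mem\<close>
      forbids.\<close>
    have "z * ?c ^ n = (\<Sum>i<n. a i * inverse ?c ^ i) * ?c ^ n"
      by (rule arg_cong[OF a(1)])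
    also have "\<dots> = (\<Sum>i<n. a i * ?c ^ (n - i))"
      unfolding sum_distrib_right
    proof (intro sum.cong refl)
      fix i assume "i \<in> {..<n}"
      then have "?c ^ n = ?c ^ i * ?c ^ (n - i)" by (simp flip: power_add)
      then show "a i * inverse ?c ^ i * ?c ^ n = a i * ?c ^ (n - i)"
        using nz by (simp add: power_inverse)
    qed
    also have "\<dots> \<in> A" using a(2) cA by (intro sum_mem mult_mem power_mem) auto
    finally show False using mem_of_mult_power_mem[OF b] by blast
  qed
qed

text \<open>Since \<open>1 - inverse z * b 0\<close> is a unit, the expression in \<open>y'\<close>
  can be solved for \<open>z\<close> using positive powers of \<open>y'\<close> only. Multiplying
  the top term \<open>a n' * y ^ n'\<close> by this lowers its degree, so the expression in
  \<open>y\<close> gets shorter, against its minimality.\<close>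

lemma no_minimal_pair:
  assumes yy: "y * y' = 1" and n: "z \<in> pow_span n y" and m: "z \<in> pow_span m y'"
    and min: "\<And>k. z \<in> pow_span k y \<Longrightarrow> n \<le> k" and le: "m \<le> n"
  shows False
proof -
  obtain a where a: "z = (\<Sum>i<n. a i * y ^ i)" "\<forall>i. a i \<in> A" using n by (auto simp: pow_span_def)
  obtain b where b: "z = (\<Sum>i<m. b i * y' ^ i)" "\<forall>i. b i \<in> A" using m by (auto simp: pow_span_def)
  have "n \<noteq> 0" using a z_nonzero by (intro notI) auto
  then obtain n' where n': "n = Suc n'" by (cases n) auto
  have "m \<noteq> 0" using b z_nonzero by (intro notI) auto
  then obtain m' where m': "m = Suc m'" by (cases m) auto
  let ?c = "1 - inverse z * b 0"
  have c: "inverse ?c \<in> A" "?c \<noteq> 0" using inverse_one_minus_mem b by blast+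
  \<comment> \<open>\<open>e\<close> collects the top coefficient and the two inverses. The top term
    becomes a sum of \<open>e * b (Suc j) * y ^ (n' - Suc j)\<close>, where \<open>m \<le> n\<close>
    ensures that the subtraction does not truncate.\<close>
  define e where "e = a n' * inverse ?c * inverse z"
  have eA: "e \<in> A" unfolding e_def using a c inverse_mem by (intro mult_mem) auto
  have "z = b 0 + (\<Sum>j<m'. b (Suc j) * y' ^ Suc j)"
    using b(1) unfolding m' sum.lessThan_Suc_shift by simp
  moreover have "z * ?c = z - b 0" using z_nonzero by (simp add: algebra_simps)
  ultimately have "z * ?c = (\<Sum>j<m'. b (Suc j) * y' ^ Suc j)" by (simp add: algebra_simps)
  then have "z = inverse ?c * (\<Sum>j<m'. b (Suc j) * y' ^ Suc j)"
    using c(2) by (simp add: field_simps)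
  then have "a n' * y ^ n' = inverse z * (inverse ?c * (\<Sum>j<m'. b (Suc j) * y' ^ Suc j)) * (a n' * y ^ n')"
    using z_nonzero by simp
  also have "\<dots> = (\<Sum>j<m'. e * b (Suc j) * (y ^ n' * y' ^ Suc j))"
    by (simp add: e_def sum_distrib_left sum_distrib_right mult_ac)
  also have "\<dots> = (\<Sum>j<m'. e * b (Suc j) * y ^ (n' - Suc j))"
  proof (intro sum.cong refl)
    fix j assume "j \<in> {..<m'}"
    then have "y ^ n' = y ^ (n' - Suc j) * y ^ Suc j" using le by (simp add: n' m' flip: power_add del: power_Suc)
    then have "y ^ n' * y' ^ Suc j = y ^ (n' - Suc j) * (y * y') ^ Suc j"
      by (simp only: power_mult_distrib mult.assoc)
    then show "e * b (Suc j) * (y ^ n' * y' ^ Suc j) = e * b (Suc j) * y ^ (n' - Suc j)"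
      by (simp add: yy)
  qed
  also have "\<dots> \<in> pow_span n' y"
    using le b eA by (intro pow_span_sum pow_span_monom mult_mem) (auto simp: n' m')
  finally have "a n' * y ^ n' \<in> pow_span n' y" .
  moreover have "(\<Sum>i<n'. a i * y ^ i) \<in> pow_span n' y"
    using a by (intro pow_span_sum pow_span_monom) auto
  ultimately have "z \<in> pow_span n' y"
    using pow_span_add a(1) unfolding n' by (metis sum.lessThan_Suc)
  then show False using min[of n'] n' by simp
qed

text \<open>If neither \<open>y\<close> nor \<open>inverse y\<close> is in \<open>A\<close>,
  maximality puts \<open>z\<close> into both \<open>adjoin y\<close> and
  \<open>adjoin (inverse y)\<close>. \<open>no_minimal_pair\<close> is symmetric in the two, so it
  is applied to whichever shortest expression is longer.\<close>

sublocale valuation_ring A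
proof
  fix y show "y \<in> A \<or> inverse y \<in> A"
  proof (rule ccontr)
    assume "\<not> ?thesis"
    then have "z \<in> adjoin y" "z \<in> adjoin (inverse y)" "y \<noteq> 0"
      using mem_adjoin_of_notin zero_mem by auto
    then obtain n0 m0 where nm0: "z \<in> pow_span n0 y" "z \<in> pow_span m0 (inverse y)" and y: "y \<noteq> 0"
      by (meson adjoin_imp_pow_span)
    define n m where "n = (LEAST n. z \<in> pow_span n y)" "m = (LEAST m. z \<in> pow_span m (inverse y))"
    have n: "z \<in> pow_span n y" "\<And>k. z \<in> pow_span k y \<Longrightarrow> n \<le> k"
      unfolding n_m_def by (rule LeastI[of _ n0], fact) (rule Least_le)
    have m: "z \<in> pow_span m (inverse y)" "\<And>k. z \<in> pow_span k (inverse y) \<Longrightarrow> m \<le> k"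
      unfolding n_m_def by (rule LeastI[of _ m0], fact) (rule Least_le)
    show False
      using no_minimal_pair[OF _ n(1) m(1) n(2)] no_minimal_pair[OF _ m(1) n(1) m(2)] y
      by (cases "m \<le> n") auto
  qed
qed

end

text \<open>An expression of \<open>z\<close> as an integral polynomial of degree below
  \<open>n\<close> in \<open>inverse z\<close>, multiplied by \<open>z ^ n\<close>, is a monic
  equation for \<open>z\<close>. So a non-integral \<open>z\<close> avoids the ring
  \<open>Z.adjoin (inverse z)\<close>, which is where Zorn's lemma starts.\<close>

theorem algebraic_int_if_mem_valuation_rings:
  fixes z :: "'b::field_char_0"
  assumes all: "\<And>V. valuation_ring V \<Longrightarrow> z \<in> V"
  shows "algebraic_int z"
proof (rule ccontr)
  assume nalg: "\<not> algebraic_int z"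
  then have z0: "z \<noteq> 0" by auto
  interpret Z: subring_of_field "\<int> :: 'b set" by unfold_locales auto
  let ?\<A> = "{B. subring_of_field B \<and> inverse z \<in> B \<and> z \<notin> B}"
  have "z \<notin> Z.adjoin (inverse z)"
  proof
    assume "z \<in> Z.adjoin (inverse z)"
    then obtain n where "z \<in> Z.pow_span n (inverse z)" by (rule Z.adjoin_imp_pow_span)
    then obtain a where a: "z = (\<Sum>i<n. a i * inverse z ^ i)" "\<forall>i. a i \<in> \<int>"
      by (auto simp: Z.pow_span_def)
    define P where "P = monom 1 (Suc n) - (\<Sum>i<n. monom (a i) (n - i))"
    have cP: "coeff P j = (if j = Suc n then 1 else 0) - (\<Sum>i<n. if n - i = j then a i else 0)" for j
      by (auto simp: P_def coeff_sum coeff_monom)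
    have top: "coeff P (Suc n) = 1" unfolding cP by (auto intro!: sum.neutral)
    have "degree P \<le> Suc n" using cP by (intro degree_le) (auto intro!: sum.neutral)
    then have deg: "degree P = Suc n" using top le_degree[of P "Suc n"] by auto
    have "poly P z = z ^ Suc n - (\<Sum>i<n. a i * z ^ (n - i))"
      by (simp add: P_def poly_monom poly_sum)
    also have "(\<Sum>i<n. a i * z ^ (n - i)) = (\<Sum>i<n. a i * inverse z ^ i) * z ^ n"
      unfolding sum_distrib_right
    proof (intro sum.cong refl)
      fix i assume "i \<in> {..<n}"
      then have "z ^ n = z ^ i * z ^ (n - i)" by (simp flip: power_add)
      then show "a i * z ^ (n - i) = a i * inverse z ^ i * z ^ n" using z0 by (simp add: power_inverse)
    qed
    finally have "poly P z = 0" using a(1) by simp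
    moreover have "\<forall>j. coeff P j \<in> \<int>"
      unfolding cP using a(2) by (auto intro!: Ints_diff Z.sum_mem)
    ultimately show False using nalg algebraic_int.intros[of P z] top deg by simp
  qed
  then have "?\<A> \<noteq> {}" using Z.subring_adjoin Z.mem_adjoin by blast
  moreover have "\<Union>\<C> \<in> ?\<A>" if ne: "\<C> \<noteq> {}" and ch: "subset.chain ?\<A> \<C>" for \<C>
  proof -
    have sub: "subring_of_field B" "inverse z \<in> B" "z \<notin> B" if "B \<in> \<C>" for B
      using ch that by (auto simp: subset.chain_def)
    have "subring_of_field (\<Union>\<C>)"
    proof
      show "1 \<in> \<Union>\<C>" using ne sub(1) subring_of_field.one_mem by blast
    next
      fix x y assume "x \<in> \<Union>\<C>" "y \<in> \<Union>\<C>"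
      then obtain B where B: "B \<in> \<C>" "x \<in> B" "y \<in> B"
        using ch unfolding subset.chain_def by blast
      then show "x - y \<in> \<Union>\<C>" "x * y \<in> \<Union>\<C>"
        using sub(1)[of B] subring_of_field.diff_mem subring_of_field.mult_mem by blast+
    qed
    then show ?thesis using ne sub by auto
  qed
  ultimately obtain A where A: "A \<in> ?\<A>" "\<forall>X\<in>?\<A>. A \<subseteq> X \<longrightarrow> X = A"
    using subset_Zorn_nonempty[of ?\<A>] by blast
  then interpret subring_of_field A by simp
  interpret maximal_subring_avoiding A z
    using A by unfold_locales auto
  show False using all[OF valuation_ring_axioms] notin by blast
qed

section \<open>Units, the maximal ideal and congruences in a valuation ring\<close>

context valuation_ring
begin

text \<open>The nonunits; \<open>x = 0\<close> is listed separately because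
  \<open>inverse 0 = 0\<close> lies in \<open>V\<close>.\<close>

definition max_ideal :: "'b set" where
  "max_ideal = {x \<in> V. x = 0 \<or> inverse x \<notin> V}"

definition unit :: "'b \<Rightarrow> bool" where
  "unit x \<longleftrightarrow> x \<noteq> 0 \<and> x \<in> V \<and> inverse x \<in> V"

text \<open>Both sides are required to lie in \<open>V\<close>, which makes the relation compatible
  with multiplication.\<close>

definition cg :: "'b \<Rightarrow> 'b \<Rightarrow> bool" (infix "\<doteq>" 50) where
  "x \<doteq> y \<longleftrightarrow> x \<in> V \<and> y \<in> V \<and> x - y \<in> max_ideal"

lemma unitD: "unit x \<Longrightarrow> x \<noteq> 0" "unit x \<Longrightarrow> x \<in> V" "unit x \<Longrightarrow> inverse x \<in> V"
  by (auto simp: unit_def)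

lemma max_ideal_subset: "x \<in> max_ideal \<Longrightarrow> x \<in> V"
  by (simp add: max_ideal_def)

lemma unit_iff: "x \<in> V \<Longrightarrow> unit x \<longleftrightarrow> x \<notin> max_ideal"
  by (auto simp: max_ideal_def unit_def)

lemma unit_not_max_ideal: "unit x \<Longrightarrow> x \<notin> max_ideal"
  using unit_iff unitD by blast

lemma unit_one: "unit 1"
  by (simp add: unit_def one_mem)

lemma unit_mult: "unit x \<Longrightarrow> unit y \<Longrightarrow> unit (x * y)"
  by (auto simp: unit_def mult_mem)

lemma unit_inverse: "unit x \<Longrightarrow> unit (inverse x)"
  by (auto simp: unit_def)

lemma unit_divide: "unit x \<Longrightarrow> unit y \<Longrightarrow> unit (x / y)"
  unfolding divide_inverse by (intro unit_mult unit_inverse)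

lemma unit_uminus: "unit x \<Longrightarrow> unit (- x)"
  by (auto simp: unit_def uminus_mem)

lemma unit_power: "unit x \<Longrightarrow> unit (x ^ n)"
  by (induction n) (auto intro: unit_one unit_mult)

lemma unit_powi: "unit x \<Longrightarrow> unit (x powi k)"
  by (auto simp: power_int_def intro: unit_power unit_inverse)

lemma unit_prod: "(\<And>i. i \<in> I \<Longrightarrow> unit (h i)) \<Longrightarrow> unit (prod h I)"
  by (induction I rule: infinite_finite_induct) (auto intro: unit_one unit_mult)

lemma unit_factor:
  assumes "unit (x * y)" "x \<in> V" "y \<in> V" shows "unit x"
proof -
  have "x \<noteq> 0" "y \<noteq> 0" using unitD(1)[OF assms(1)] by auto
  then have "inverse x = y * inverse (x * y)" by simp
  then have "inverse x \<in> V" using mult_mem[OF assms(3) unitD(3)[OF assms(1)]] by metis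
  then show ?thesis using \<open>x \<noteq> 0\<close> assms by (simp add: unit_def)
qed

text \<open>A root of unity \<open>y\<close> outside \<open>V\<close> would have its inverse in
  \<open>V\<close>, and then \<open>y = inverse y ^ (n - 1)\<close> would lie in \<open>V\<close>
  after all.\<close>

lemma unit_root_of_unity:
  assumes "x ^ n = 1" "n > 0" shows "unit x"
proof -
  have *: "y \<in> V" if y: "y ^ n = 1" for y :: 'b
  proof (rule ccontr)
    assume "y \<notin> V"
    then have "inverse y \<in> V" using mem_or_inverse_mem by blast
    moreover have "y * y ^ (n - 1) = 1" using y assms(2) by (metis power_minus_mult mult.commute)
    then have "y = inverse (y ^ (n - 1))" by (metis inverse_unique inverse_inverse_eq)
    then have "y = inverse y ^ (n - 1)" by (simp only: power_inverse)
    ultimately show False using \<open>y \<notin> V\<close> power_mem by metis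
  qed
  have "x \<noteq> 0" using assms by (auto simp: power_0_left)
  moreover have "inverse x ^ n = 1" using assms by (simp add: power_inverse)
  ultimately show ?thesis using *[OF assms(1)] *[of "inverse x"] by (simp add: unit_def)
qed

lemma zero_max_ideal: "0 \<in> max_ideal"
  by (simp add: max_ideal_def zero_mem)

lemma one_notin_max_ideal: "1 \<notin> max_ideal"
  using unit_iff[OF one_mem] unit_one by simp

lemma max_ideal_mult: "a \<in> V \<Longrightarrow> x \<in> max_ideal \<Longrightarrow> a * x \<in> max_ideal"
  using unit_iff unit_factor[of x a] max_ideal_subset mult_mem by (metis mult.commute)

lemma max_ideal_mult': "x \<in> max_ideal \<Longrightarrow> a \<in> V \<Longrightarrow> x * a \<in> max_ideal"
  using max_ideal_mult by (simp add: mult.commute)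

text \<open>Of two nonzero elements one divides the other in \<open>V\<close>, so the sum is a
  multiple of one of them.\<close>

lemma max_ideal_add:
  assumes "x \<in> max_ideal" "y \<in> max_ideal" shows "x + y \<in> max_ideal"
proof -
  have *: "x + y \<in> max_ideal" if "x \<in> max_ideal" "y \<in> max_ideal" "y \<noteq> 0" "x / y \<in> V" for x y
  proof -
    have "(x / y + 1) * y \<in> max_ideal" using that by (intro max_ideal_mult add_mem one_mem)
    then show ?thesis using that(3) by (simp add: distrib_right)
  qed
  show ?thesis
  proof (cases "x = 0 \<or> y = 0")
    case False
    have "x / y \<in> V \<or> y / x \<in> V" using mem_or_inverse_mem[of "x / y"] by simp
    then show ?thesis using *[of x y] *[of y x] False assms by (auto simp: add.commute)
  qed (use assms in auto)
qed

lemma max_ideal_uminus: "x \<in> max_ideal \<Longrightarrow> - x \<in> max_ideal"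
  using max_ideal_mult[OF uminus_mem[OF one_mem]] by simp

lemma max_ideal_sum: "(\<And>i. i \<in> I \<Longrightarrow> h i \<in> max_ideal) \<Longrightarrow> sum h I \<in> max_ideal"
  by (induction I rule: infinite_finite_induct) (auto intro: zero_max_ideal max_ideal_add)

lemma max_ideal_prime: "x \<in> V \<Longrightarrow> y \<in> V \<Longrightarrow> x * y \<in> max_ideal \<Longrightarrow> x \<in> max_ideal \<or> y \<in> max_ideal"
  using unit_iff unit_mult unit_not_max_ideal by blast

lemma max_ideal_of_power: "x \<in> V \<Longrightarrow> x ^ n \<in> max_ideal \<Longrightarrow> x \<in> max_ideal"
  using unit_iff unit_power unit_not_max_ideal by blast

lemma cg_refl: "x \<in> V \<Longrightarrow> x \<doteq> x"
  by (simp add: cg_def zero_max_ideal)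

lemma cg_sym: "x \<doteq> y \<Longrightarrow> y \<doteq> x"
  using max_ideal_uminus[of "x - y"] by (simp add: cg_def)

lemma cg_trans [trans]: "x \<doteq> y \<Longrightarrow> y \<doteq> z \<Longrightarrow> x \<doteq> z"
  using max_ideal_add[of "x - y" "y - z"] by (simp add: cg_def)

lemma cg_add: "x \<doteq> y \<Longrightarrow> x' \<doteq> y' \<Longrightarrow> x + x' \<doteq> y + y'"
  using max_ideal_add[of "x - y" "x' - y'"] by (simp add: cg_def add_mem algebra_simps)

lemma cg_mult: 
  assumes "x \<doteq> y" "x' \<doteq> y'" shows "x * x' \<doteq> y * y'"
proof -
  have "(x - y) * x' + y * (x' - y') \<in> max_ideal"
    using assms by (intro max_ideal_add max_ideal_mult max_ideal_mult') (auto simp: cg_def)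
  then show ?thesis using assms by (auto simp: cg_def algebra_simps intro: mult_mem)
qed

lemma cg_power: "x \<doteq> y \<Longrightarrow> x ^ n \<doteq> y ^ n"
  by (induction n) (auto intro: cg_mult cg_refl one_mem)

lemma cg_sum: "(\<And>i. i \<in> I \<Longrightarrow> h i \<doteq> k i) \<Longrightarrow> sum h I \<doteq> sum k I"
  by (induction I rule: infinite_finite_induct) (auto intro: cg_add cg_refl zero_mem)

lemma unit_cg: "unit x \<Longrightarrow> x \<doteq> y \<Longrightarrow> unit y"
  using unit_iff max_ideal_add[of "x - y" y] unit_not_max_ideal[of x] by (auto simp: cg_def)

lemma unit_of_nat_coprime:
  assumes "of_nat p \<in> max_ideal" "coprime m p" shows "unit (of_nat m)"
proof (rule ccontr)
  assume "\<not> unit (of_nat m)"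
  then have m: "of_nat m \<in> max_ideal" using unit_iff of_nat_mem by blast
  have "\<exists>x y. int m * x + int p * y = 1"
    using assms(2) by (metis bezout_int coprime_imp_gcd_eq_1 coprime_int_iff mult.commute)
  then obtain x y where "int m * x + int p * y = 1" by blast
  then have "(of_int (int m * x + int p * y) :: 'b) = 1" by simp
  then have "of_nat m * of_int x + of_nat p * of_int y = (1 :: 'b)" by simp
  moreover have "of_nat m * of_int x + of_nat p * of_int y \<in> max_ideal"
    using m assms(1) of_int_mem by (intro max_ideal_add max_ideal_mult')
  ultimately show False using one_notin_max_ideal by simp
qed

end

section \<open>Characters and Gauss sums of a finite field\<close>

lemma prime_CHAR_finite_field: "prime CHAR('a::{field,finite})"
  by (intro prime_CHAR_semidom finite_imp_CHAR_pos) simp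

lemma finite_field_power_card:
  fixes x :: "'a::{field,finite}"
  shows "x ^ CARD('a) = x"
proof (cases "x = 0")
  case False
  have "x * (\<Prod>y\<in>UNIV-{0}. x * y) = x * x ^ (CARD('a) - 1) * \<Prod>(UNIV-{0})"
    by (simp add: prod.distrib mult_ac)
  also have "x * x ^ (CARD('a) - 1) = x ^ CARD('a)"
    by (metis power_eq_if zero_less_card_finite less_numeral_extra(3))
  also have "(\<Prod>y\<in>UNIV-{0}. x * y) = (\<Prod>y\<in>UNIV-{0}. y)"
    by (rule prod.reindex_bij_witness[of _ "\<lambda>y. y / x" "\<lambda>y. x * y"]) (use False in auto)
  finally show ?thesis by simp
qed (simp add: power_0_left)

text \<open>A maximal additive subgroup \<open>H\<close> of \<open>p\<close>-power order is everything: if \<open>x \<notin> H\<close>, then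
  \<open>H + \<FF>\<^sub>p x\<close> is larger.\<close>

lemma card_finite_field_eq_CHAR_power: "\<exists>f. CARD('a::{field,finite}) = CHAR('a) ^ f"
proof -
  let ?p = "CHAR('a)"
  have p: "prime ?p" by (rule prime_CHAR_finite_field)
  define ok where "ok H \<longleftrightarrow> 0 \<in> H \<and> (\<forall>x\<in>H. \<forall>y\<in>H. x + y \<in> H) \<and> (\<exists>j. card H = ?p ^ j)" for H :: "'a set"
  have "ok {0}" unfolding ok_def by (auto intro: exI[of _ 0])
  moreover have "\<forall>H. ok H \<longrightarrow> card H < Suc CARD('a)" by (simp add: card_mono less_Suc_eq_le)
  ultimately obtain H where H: "ok H" and max: "\<And>H'. ok H' \<Longrightarrow> card H' \<le> card H"
    using ex_has_greatest_nat[of ok "{0}" card "Suc CARD('a)"] by blast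
  have H0: "0 \<in> H" and Hadd: "\<And>x y. x \<in> H \<Longrightarrow> y \<in> H \<Longrightarrow> x + y \<in> H" using H by (auto simp: ok_def)
  have Hmul: "of_nat n * x \<in> H" if "x \<in> H" for n x
    by (induction n) (auto simp: distrib_right H0 intro: Hadd that)
  have Hneg: "- x \<in> H" if "x \<in> H" for x
  proof -
    have "of_nat (?p - 1) * x = of_nat ?p * x - x"
      using prime_gt_0_nat[OF p] by (simp add: of_nat_diff left_diff_distrib del: of_nat_CHAR)
    then show ?thesis using Hmul[OF that, of "?p - 1"] by simp
  qed
  have "H = UNIV"
  proof (rule ccontr)
    assume "H \<noteq> UNIV"
    then obtain x where x: "x \<notin> H" by blast
    define F where "F = (\<lambda>(h, i). h + of_nat i * x)"
    have neq: False if "i < j" "j < ?p" "h + of_nat i * x = h' + of_nat j * x" "h \<in> H" "h' \<in> H" for i j h h'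
    proof -
      have "of_nat (j - i) * x = h + - h'"
        using that(1,3) by (simp add: of_nat_diff algebra_simps)
      then have k: "of_nat (j - i) * x \<in> H" using that Hadd Hneg by metis
      \<comment> \<open>An inverse of \<open>j - i\<close> modulo \<open>p\<close> recovers
        \<open>x\<close> from \<open>of_nat (j - i) * x\<close>, so \<open>x\<close> itself would
        lie in \<open>H\<close>.\<close>
      have "coprime (j - i) ?p"
        using p that by (metis coprime_commute diff_is_0_eq' dvd_imp_le le_trans less_imp_diff_less not_le
            prime_imp_coprime zero_less_diff)
      then obtain a where "[(j - i) * a = Suc 0] (mod ?p)" using cong_solve_coprime_nat by blast
      then have "of_nat ((j - i) * a) = (1 :: 'a)" using of_nat_eq_iff_cong_CHAR by (metis of_nat_1 One_nat_def)
      then have "x = of_nat a * (of_nat (j - i) * x)" by (simp add: mult_ac flip: of_nat_mult)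
      then show False using Hmul[OF k] x by metis
    qed
    have "inj_on F (H \<times> {..<?p})"
    proof (rule inj_onI)
      fix u v assume uv: "u \<in> H \<times> {..<?p}" "v \<in> H \<times> {..<?p}" "F u = F v"
      obtain h i h' j where [simp]: "u = (h, i)" "v = (h', j)" by (cases u, cases v)
      have "i = j" using neq[of i j h h'] neq[of j i h' h] uv by (cases i j rule: linorder_cases) (auto simp: F_def)
      then show "u = v" using uv by (auto simp: F_def)
    qed
    then have card: "card (F ` (H \<times> {..<?p})) = card H * ?p" by (simp add: card_image)
    have "ok (F ` (H \<times> {..<?p}))"
      unfolding ok_def
    proof (intro conjI ballI)
      have "F (0, 0) \<in> F ` (H \<times> {..<?p})" using H0 prime_gt_0_nat[OF p] by (intro imageI) auto
      then show "0 \<in> F ` (H \<times> {..<?p})" by (simp add: F_def)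
      show "\<exists>j. card (F ` (H \<times> {..<?p})) = ?p ^ j"
        using H card unfolding ok_def by (metis power_Suc2)
      fix a b assume "a \<in> F ` (H \<times> {..<?p})" "b \<in> F ` (H \<times> {..<?p})"
      then obtain h i h' j where ab: "a = h + of_nat i * x" "b = h' + of_nat j * x" "h \<in> H" "h' \<in> H"
        by (auto simp: F_def)
      have "(of_nat ((i + j) mod ?p) :: 'a) = of_nat (i + j)"
        using of_nat_eq_iff_cong_CHAR[where 'a='a, of "(i + j) mod ?p" "i + j"] by (simp add: cong_def del: of_nat_add)
      then have "a + b = F (h + h', (i + j) mod ?p)"
        by (simp add: F_def ab algebra_simps)
      also have "\<dots> \<in> F ` (H \<times> {..<?p})" using ab Hadd prime_gt_0_nat[OF p] by (intro imageI) auto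
      finally show "a + b \<in> F ` (H \<times> {..<?p})" .
    qed
    then have "card H * ?p \<le> card H" using max card by metis
    moreover have "card H > 0" using H0 by (metis card_gt_0_iff empty_iff finite)
    ultimately show False using prime_gt_1_nat[OF p] by simp
  qed
  then show ?thesis using H by (auto simp: ok_def)
qed

text \<open>\<open>omega_order\<close> says that \<omega> has exact order \<open>q - 1\<close>,
  which is how it generates the character group. The value of \<omega> at 0 is left free, so sums of
  its powers have to avoid 0.\<close>

locale gauss_chars =
  fixes \<psi> \<omega> :: "'a::{field,finite} \<Rightarrow> complex"
  assumes psi_add: "\<psi> (x + y) = \<psi> x * \<psi> y"
    and psi_nz: "\<psi> x \<noteq> 0"
    and psi_nontriv: "\<exists>x. \<psi> x \<noteq> 1"
    and omega_mult: "x \<noteq> 0 \<Longrightarrow> y \<noteq> 0 \<Longrightarrow> \<omega> (x * y) = \<omega> x * \<omega> y"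
    and omega_nz: "x \<noteq> 0 \<Longrightarrow> \<omega> x \<noteq> 0"
    and omega_order: "(\<forall>x. x \<noteq> 0 \<longrightarrow> \<omega> x ^ k = 1) \<longleftrightarrow> (CARD('a) - 1) dvd k"
begin

abbreviation U :: "'a set" where "U \<equiv> {x. x \<noteq> 0}"
abbreviation g :: "int \<Rightarrow> complex" where "g \<equiv> gauss_sum \<omega> \<psi>"

lemma card_gt_1: "CARD('a) > 1"
proof -
  have "card {0, 1 :: 'a} \<le> CARD('a)" by (rule card_mono) auto
  then show ?thesis by simp
qed

lemma card_U: "card U = CARD('a) - 1"
proof -
  have "U = UNIV - {0}" by auto
  then show ?thesis by simp
qed

lemma omega_1: "\<omega> 1 = 1"
  using omega_mult[of 1 1] omega_nz[of 1] by simp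

lemma omega_root: "x \<noteq> 0 \<Longrightarrow> \<omega> x ^ (CARD('a) - 1) = 1"
  using omega_order[of "CARD('a) - 1"] by simp

lemma omega_powi_mult: "x \<noteq> 0 \<Longrightarrow> y \<noteq> 0 \<Longrightarrow> \<omega> (x * y) powi a = \<omega> x powi a * \<omega> y powi a"
  by (simp add: omega_mult power_int_mult_distrib)

lemma omega_power: "x \<noteq> 0 \<Longrightarrow> \<omega> (x ^ n) = \<omega> x ^ n"
  by (induction n) (auto simp: omega_1 omega_mult)

lemma omega_powi_period:
  assumes "x \<noteq> 0" "int (CARD('a) - 1) dvd a - b" shows "\<omega> x powi a = \<omega> x powi b"
proof -
  obtain k where "a = b + int (CARD('a) - 1) * k" using assms(2) by (auto elim!: dvdE simp: algebra_simps)
  then show ?thesis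
    using omega_root[OF assms(1)] omega_nz[OF assms(1)]
    by (simp add: power_int_add power_int_mult del: of_nat_diff of_nat_diff_if One_nat_def)
qed

lemma omega_powi_trivial_iff: "(\<forall>x. x \<noteq> 0 \<longrightarrow> \<omega> x powi a = 1) \<longleftrightarrow> int (CARD('a) - 1) dvd a"
proof -
  define n where "n = nat (a mod int (CARD('a) - 1))"
  have n: "int n = a mod int (CARD('a) - 1)" using card_gt_1 by (simp add: n_def)
  have "\<omega> x powi a = \<omega> x ^ n" if "x \<noteq> 0" for x
    using omega_powi_period[OF that, of a "int n"] n
    by (metis minus_mod_eq_mult_div dvd_triv_left power_int_of_nat)
  then have "(\<forall>x. x \<noteq> 0 \<longrightarrow> \<omega> x powi a = 1) \<longleftrightarrow> (CARD('a) - 1) dvd n" using omega_order[of n] by auto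
  also have "\<dots> \<longleftrightarrow> int (CARD('a) - 1) dvd int n" by (rule int_dvd_int_iff[symmetric])
  also have "\<dots> \<longleftrightarrow> int (CARD('a) - 1) dvd a" unfolding n by (simp add: dvd_mod_iff)
  finally show ?thesis .
qed

lemma sum_omega_powi: "(\<Sum>x\<in>U. \<omega> x powi a) = (if int (CARD('a) - 1) dvd a then of_nat (CARD('a) - 1) else 0)"
proof (cases "int (CARD('a) - 1) dvd a")
  case True
  then have "(\<Sum>x\<in>U. \<omega> x powi a) = (\<Sum>x\<in>U. 1)"
    using omega_powi_trivial_iff[of a] by (intro sum.cong) auto
  then show ?thesis using True card_U by simp
next
  case False
  then obtain y where y: "y \<noteq> 0" "\<omega> y powi a \<noteq> 1" using omega_powi_trivial_iff by blast
  have "(\<Sum>x\<in>U. \<omega> x powi a) = (\<Sum>x\<in>U. \<omega> (y * x) powi a)"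
    by (rule sum.reindex_bij_witness[of _ "\<lambda>x. y * x" "\<lambda>x. x / y"]) (use y in auto)
  also have "\<dots> = \<omega> y powi a * (\<Sum>x\<in>U. \<omega> x powi a)"
    unfolding sum_distrib_left using y by (intro sum.cong) (auto simp: omega_powi_mult)
  finally show ?thesis using y False by simp
qed

lemma psi_0: "\<psi> 0 = 1"
  using psi_add[of 0 0] psi_nz[of 0] by simp

lemma psi_of_nat_mult: "\<psi> (of_nat n * x) = \<psi> x ^ n"
  by (induction n) (auto simp: psi_0 distrib_right psi_add)

lemma psi_root: "\<psi> x ^ CHAR('a) = 1"
  using psi_of_nat_mult[of "CHAR('a)" x] psi_0 by simp

lemma sum_psi: "(\<Sum>x\<in>UNIV. \<psi> (c * x)) = (if c = 0 then of_nat CARD('a) else 0)"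
proof (cases "c = 0")
  case False
  obtain y where y: "\<psi> y \<noteq> 1" using psi_nontriv by blast
  have "(\<Sum>x\<in>UNIV. \<psi> (c * x)) = (\<Sum>x\<in>UNIV. \<psi> (c * (x + y / c)))"
    by (rule sum.reindex_bij_witness[of _ "\<lambda>x. x + y / c" "\<lambda>x. x - y / c"]) auto
  also have "\<dots> = (\<Sum>x\<in>UNIV. \<psi> (c * x)) * \<psi> y"
    using False by (simp add: distrib_left psi_add sum_distrib_right)
  finally show ?thesis using y False by simp
qed (simp add: psi_0)

lemma sum_psi_U: "(\<Sum>x\<in>U. \<psi> (c * x)) = (if c = 0 then of_nat CARD('a) else 0) - 1"
proof -
  have "(\<Sum>x\<in>UNIV. \<psi> (c * x)) = \<psi> (c * 0) + (\<Sum>x\<in>UNIV - {0}. \<psi> (c * x))"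
    by (rule sum.remove) auto
  moreover have "UNIV - {0} = U" by auto
  ultimately show ?thesis using sum_psi[of c] psi_0 by simp
qed

lemma gauss_sum_period: "int (CARD('a) - 1) dvd a - b \<Longrightarrow> g a = g b"
  unfolding gauss_sum_def by (intro sum.cong refl arg_cong2[of _ _ _ _ "(*)"] omega_powi_period) auto

lemma gauss_sum_trivial: "int (CARD('a) - 1) dvd a \<Longrightarrow> g a = - 1"
  using gauss_sum_period[of a 0] sum_psi_U[of 1] by (simp add: gauss_sum_def)

text \<open>The substitution \<open>x = z * y\<close> makes the sum over \<open>y\<close> purely
  additive. Its orthogonality isolates \<open>z = -1\<close> and leaves a sum of
  \<open>\<omega> z powi a\<close>, which is zero by the assumption on \<open>a\<close>.\<close>

lemma gauss_sum_reflect: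
  assumes "\<not> int (CARD('a) - 1) dvd a"
  shows "g a * g (- a) = \<omega> (-1) powi a * of_nat CARD('a)"
proof -
  have "g a * g (- a) = (\<Sum>x\<in>U. \<Sum>y\<in>U. (\<omega> x powi a * \<psi> x) * (\<omega> y powi (- a) * \<psi> y))"
    by (simp add: gauss_sum_def sum_product)
  also have "\<dots> = (\<Sum>y\<in>U. \<Sum>x\<in>U. (\<omega> x powi a * \<psi> x) * (\<omega> y powi (- a) * \<psi> y))"
    by (rule sum.swap)
  also have "\<dots> = (\<Sum>y\<in>U. \<Sum>z\<in>U. \<omega> z powi a * \<psi> ((z + 1) * y))"
  proof (rule sum.cong[OF refl])
    fix y assume y: "y \<in> U"
    have "(\<Sum>x\<in>U. (\<omega> x powi a * \<psi> x) * (\<omega> y powi (- a) * \<psi> y)) =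
        (\<Sum>z\<in>U. (\<omega> (z * y) powi a * \<psi> (z * y)) * (\<omega> y powi (- a) * \<psi> y))"
      by (rule sum.reindex_bij_witness[of _ "\<lambda>z. z * y" "\<lambda>x. x / y"]) (use y in auto)
    also have "\<dots> = (\<Sum>z\<in>U. \<omega> z powi a * \<psi> ((z + 1) * y))"
    proof (intro sum.cong refl)
      fix z assume z: "z \<in> U"
      then show "(\<omega> (z * y) powi a * \<psi> (z * y)) * (\<omega> y powi (- a) * \<psi> y) = \<omega> z powi a * \<psi> ((z + 1) * y)"
        using y omega_nz by (simp add: omega_powi_mult distrib_right psi_add power_int_minus)
    qed
    finally show "(\<Sum>x\<in>U. (\<omega> x powi a * \<psi> x) * (\<omega> y powi (- a) * \<psi> y)) =
      (\<Sum>z\<in>U. \<omega> z powi a * \<psi> ((z + 1) * y))" .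
  qed
  also have "\<dots> = (\<Sum>z\<in>U. \<Sum>y\<in>U. \<omega> z powi a * \<psi> ((z + 1) * y))"
    by (rule sum.swap)
  also have "\<dots> = (\<Sum>z\<in>U. \<omega> z powi a * ((if z = -1 then of_nat CARD('a) else 0) - 1))"
    by (simp only: sum_distrib_left[symmetric] sum_psi_U eq_neg_iff_add_eq_0)
  also have "\<dots> = (\<Sum>z\<in>U. if z = -1 then \<omega> z powi a * of_nat CARD('a) else 0) - (\<Sum>z\<in>U. \<omega> z powi a)"
    unfolding sum_subtractf[symmetric] by (intro sum.cong) (auto simp: algebra_simps)
  also have "\<dots> = \<omega> (-1) powi a * of_nat CARD('a)"
    using assms by (simp add: sum_omega_powi)
  finally show ?thesis .
qed

text \<open>The points 0 and 1 are removed because there \<omega> would be evaluated at 0.\<close>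

definition jacobi_sum :: "int \<Rightarrow> int \<Rightarrow> complex" where
  "jacobi_sum a b = (\<Sum>z\<in>-{0, 1}. \<omega> z powi a * \<omega> (1 - z) powi b)"

text \<open>Where \<open>x + y\<close> is nonzero, the substitution \<open>x = s * z\<close>,
  \<open>y = s * (1 - z)\<close> separates the sum into a Jacobi sum and a Gauss sum. Where
  \<open>x + y = 0\<close>, the additive characters cancel and what remains is a multiple of the sum
  of \<open>\<omega> x powi (a + b)\<close>, which vanishes.\<close>

lemma gauss_sum_mult:
  assumes "\<not> int (CARD('a) - 1) dvd a + b"
  shows "g a * g b = jacobi_sum a b * g (a + b)"
proof -
  let ?F = "\<lambda>(x, y). (\<omega> x powi a * \<psi> x) * (\<omega> y powi b * \<psi> y)"
  let ?D = "{(x, y). x \<noteq> 0 \<and> y \<noteq> 0 \<and> x + y \<noteq> (0::'a)}"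
  have "g a * g b = sum ?F (U \<times> U)"
    by (simp add: gauss_sum_def sum_product sum.cartesian_product)
  also have "U \<times> U = ?D \<union> (\<lambda>x. (x, - x)) ` U"
    by (auto simp: image_iff eq_neg_iff_add_eq_0 add.commute)
  also have "sum ?F \<dots> = sum ?F ?D + sum ?F ((\<lambda>x. (x, - x)) ` U)"
    by (rule sum.union_disjoint) auto
  also have "sum ?F ((\<lambda>x. (x, - x)) ` U) = (\<Sum>x\<in>U. \<omega> x powi (a + b) * \<omega> (-1) powi b)"
  proof (subst sum.reindex)
    show "inj_on (\<lambda>x::'a. (x, - x)) U" by (auto simp: inj_on_def)
    have "?F (x, - x) = \<omega> x powi (a + b) * \<omega> (-1) powi b" if "x \<noteq> 0" for x
    proof -
      have "\<psi> x * \<psi> (- x) = 1" using psi_add[of x "-x"] psi_0 by simp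
      moreover have "\<omega> (- x) powi b = \<omega> x powi b * \<omega> (-1) powi b"
        using omega_powi_mult[of x "-1" b] that by simp
      ultimately show ?thesis using that omega_nz by (simp add: power_int_add algebra_simps)
    qed
    then show "sum (?F \<circ> (\<lambda>x. (x, - x))) U = (\<Sum>x\<in>U. \<omega> x powi (a + b) * \<omega> (-1) powi b)"
      by (intro sum.cong) auto
  qed
  also have "\<dots> = 0" using assms by (simp add: sum_distrib_right[symmetric] sum_omega_powi)
  also have "sum ?F ?D = (\<Sum>(z, s)\<in>(-{0, 1}) \<times> U. (\<omega> z powi a * \<omega> (1 - z) powi b) * (\<omega> s powi (a + b) * \<psi> s))"
  proof (rule sum.reindex_bij_witness[of _ "\<lambda>(z, s). (s * z, s * (1 - z))" "\<lambda>(x, y). (x / (x + y), x + y)"])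
    fix w assume "w \<in> ?D"
    then obtain x y where w: "w = (x, y)" "x \<noteq> 0" "y \<noteq> 0" "x + y \<noteq> 0" by auto
    have e: "1 - x / (x + y) = y / (x + y)" using w by (simp add: field_simps)
    have x: "\<omega> x = \<omega> (x / (x + y)) * \<omega> (x + y)" and y: "\<omega> y = \<omega> (y / (x + y)) * \<omega> (x + y)"
      using w by (simp_all flip: omega_mult)
    show "(case case w of (x, y) \<Rightarrow> (x / (x + y), x + y) of (z, s) \<Rightarrow> (s * z, s * (1 - z))) = w"
      using w e by simp
    show "(case w of (x, y) \<Rightarrow> (x / (x + y), x + y)) \<in> (-{0, 1}) \<times> U"
      using w by (auto simp: field_simps)
    show "(case case w of (x, y) \<Rightarrow> (x / (x + y), x + y) of
        (z, s) \<Rightarrow> (\<omega> z powi a * \<omega> (1 - z) powi b) * (\<omega> s powi (a + b) * \<psi> s)) = ?F w"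
      using w e omega_nz[of "x + y"]
      by (simp add: psi_add x y power_int_mult_distrib power_int_add)
  next
    fix w :: "'a \<times> 'a" assume "w \<in> (-{0, 1}) \<times> U"
    then obtain z s where w: "w = (z, s)" "z \<noteq> 0" "z \<noteq> 1" "s \<noteq> 0" by auto
    have "s * z + s * (1 - z) = s" by (simp add: algebra_simps)
    then show "(case case w of (z, s) \<Rightarrow> (s * z, s * (1 - z)) of (x, y) \<Rightarrow> (x / (x + y), x + y)) = w"
      "(case w of (z, s) \<Rightarrow> (s * z, s * (1 - z))) \<in> ?D"
      using w by auto
  qed
  also have "\<dots> = jacobi_sum a b * g (a + b)"
    by (simp add: jacobi_sum_def gauss_sum_def sum_product sum.cartesian_product)
  finally show ?thesis by simp
qed

text \<open>The image \<open>?H\<close> is a finite group, so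
  \<open>\<omega> x ^ card ?H = 1\<close> for all nonzero \<open>x\<close>. The exact order
  \<open>q - 1\<close> then forces \<open>card ?H \<ge> q - 1\<close>, which leaves room neither for
  collisions nor for missed roots of unity.\<close>

lemma omega_inj: "inj_on \<omega> U" and omega_image: "\<omega> ` U = {z. z ^ (CARD('a) - 1) = 1}"
proof -
  let ?H = "\<omega> ` U"
  have "\<omega> x ^ card ?H = 1" if x: "x \<noteq> 0" for x
  proof -
    have H0: "0 \<notin> ?H" using omega_nz by force
    have "(\<Prod>y\<in>?H. \<omega> x * y) = (\<Prod>y\<in>?H. y)"
    proof (rule prod.reindex_bij_witness[of _ "\<lambda>y. y / \<omega> x" "\<lambda>y. \<omega> x * y"])
      fix y assume "y \<in> ?H"
      then obtain w where w: "w \<noteq> 0" "y = \<omega> w" by auto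
      have "\<omega> (w / x) * \<omega> x = \<omega> w" using w x by (simp flip: omega_mult)
      then have "y / \<omega> x = \<omega> (w / x)" using w omega_nz[OF x] by (simp add: field_simps)
      then show "y / \<omega> x \<in> ?H" using w x by auto
      have "\<omega> x * y = \<omega> (x * w)" using w x omega_mult by simp
      then show "\<omega> x * y \<in> ?H" using w x by auto
    qed (use omega_nz[OF x] in auto)
    then have "\<omega> x ^ card ?H * (\<Prod>y\<in>?H. y) = (\<Prod>y\<in>?H. y)" by (simp add: prod.distrib)
    moreover have "(\<Prod>y\<in>?H. y) \<noteq> 0" using H0 by (simp add: image_iff)
    ultimately show ?thesis by simp
  qed
  then have "(CARD('a) - 1) dvd card ?H" using omega_order by blast
  moreover have "card ?H > 0" by (auto simp: card_gt_0_iff intro: exI[of _ 1])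
  ultimately have "CARD('a) - 1 \<le> card ?H" by (rule dvd_imp_le)
  then have c: "card ?H = card U" using card_image_le[of U \<omega>] card_U by simp
  then show "inj_on \<omega> U" by (intro eq_card_imp_inj_on) auto
  have "card {z::complex. z ^ (CARD('a) - 1) = 1} = CARD('a) - 1" using card_gt_1 by (intro card_complex_roots_unity) auto
  then show "?H = {z. z ^ (CARD('a) - 1) = 1}"
    using c card_U omega_root card_gt_1 by (intro card_subset_eq finite_roots_unity) auto
qed

text \<open>Cyclicity of the multiplicative group of the field is transported along \<omega> from
  the group of complex \<open>(q - 1)\<close>-th roots of unity.\<close>

lemma omega_generator:
  obtains u where "u \<noteq> 0" "\<And>x. x \<noteq> 0 \<Longrightarrow> \<exists>i. x = u ^ i"
    "\<And>j. \<omega> u ^ j = 1 \<longleftrightarrow> (CARD('a) - 1) dvd j"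
proof -
  define \<zeta> where "\<zeta> = exp (2 * of_real pi * \<i> * of_nat 1 / of_nat (CARD('a) - 1))"
  have n: "1 \<le> CARD('a) - 1" using card_gt_1 by simp
  have pw: "\<zeta> ^ j = exp (2 * of_real pi * \<i> * of_nat j / of_nat (CARD('a) - 1))" for j
    unfolding \<zeta>_def by (simp add: exp_of_nat_mult[symmetric] mult_ac)
  have one: "\<zeta> ^ j = 1 \<longleftrightarrow> (CARD('a) - 1) dvd j" for j
    using complex_root_unity_eq_1[OF n, of j] by (simp add: pw)
  have roots: "\<exists>j. z = \<zeta> ^ j" if "z ^ (CARD('a) - 1) = 1" for z
    using complex_roots_unity[OF n] that by (auto simp: pw)
  obtain u where u: "u \<noteq> 0" "\<omega> u = \<zeta>" using omega_image one[of "CARD('a) - 1"] by (metis (mono_tags, lifting) dvd_refl imageE mem_Collect_eq)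
  have "\<exists>i. x = u ^ i" if x: "x \<noteq> 0" for x
  proof -
    obtain j where "\<omega> x = \<zeta> ^ j" using roots omega_root[OF x] by blast
    then have "\<omega> x = \<omega> (u ^ j)" using omega_power[OF u(1)] u(2) by metis
    then show ?thesis using inj_onD[OF omega_inj] x u(1) by (metis mem_Collect_eq power_not_zero)
  qed
  then show ?thesis using that u one by blast
qed

end

section \<open>Teichmueller characters\<close>

text \<open>Integer polynomials are the common source of two evaluations, at an element of the
  finite field and at a complex root of unity. This and the following lemmas make both of them ring
  homomorphisms.\<close>

lemma poly_of_int_pCons: "poly (map_poly of_int (pCons a P)) z = of_int a + z * poly (map_poly of_int P) z"
  by (simp add: map_poly_pCons)

lemma poly_of_int_add:
  "poly (map_poly of_int (P + Q)) z =
    poly (map_poly of_int P) z + poly (map_poly of_int Q) (z::'b::comm_ring_1)"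
proof (induction P Q rule: poly_induct2)
  case (pCons a p b q)
  then show ?case by (simp add: poly_of_int_pCons algebra_simps del: map_poly_pCons)
qed simp

lemma poly_of_int_smult:
  "poly (map_poly of_int (smult c P)) z = of_int c * poly (map_poly of_int P) (z::'b::comm_ring_1)"
proof (induction P)
  case (pCons a p)
  then show ?case by (simp add: poly_of_int_pCons algebra_simps)
qed simp

lemma poly_of_int_diff:
  "poly (map_poly of_int (P - Q)) z =
    poly (map_poly of_int P) z - poly (map_poly of_int Q) (z::'b::comm_ring_1)"
  using poly_of_int_add[of P "smult (-1) Q" z] poly_of_int_smult[of "-1" Q z] by simp

lemma poly_of_int_mult:
  "poly (map_poly of_int (P * Q)) z =
    poly (map_poly of_int P) z * poly (map_poly of_int Q) (z::'b::comm_ring_1)"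
proof (induction P)
  case (pCons a p)
  then show ?case
    by (simp add: poly_of_int_add poly_of_int_smult poly_of_int_pCons algebra_simps)
qed simp

lemma poly_of_int_monom: "poly (map_poly of_int (monom c n)) z = of_int c * (z::'b::comm_ring_1) ^ n"
  by (simp add: map_poly_monom poly_monom)

lemma poly_of_int_sum:
  fixes z :: "'b::comm_ring_1"
  assumes "\<And>i. i \<ge> n \<Longrightarrow> coeff P i = 0"
  shows "poly (map_poly of_int P) z = (\<Sum>i<n. of_int (coeff P i) * z ^ i)"
proof -
  have "P = (\<Sum>i<n. monom (coeff P i) i)"
    using assms by (intro poly_eqI) (auto simp: coeff_sum not_less)
  then have "poly (map_poly of_int P) z = poly (map_poly of_int (\<Sum>i<n. monom (coeff P i) i)) z"
    by simp
  also have "\<dots> = (\<Sum>i<n. of_int (coeff P i) * z ^ i)"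
    by (induction n) (auto simp: poly_of_int_add poly_of_int_monom)
  finally show ?thesis .
qed

text \<open>The kernel of evaluation at an element of a field of characteristic \<open>p\<close> is generated by \<open>p\<close> and a monic
  polynomial of minimal degree.\<close>

lemma minimal_monic_division:
  fixes u :: "'a::{field,finite}" and F :: "int poly"
  assumes monic: "lead_coeff F = 1" and root: "poly (map_poly of_int F) u = 0"
    and min: "\<And>Q. lead_coeff Q = 1 \<Longrightarrow> poly (map_poly of_int Q) u = 0 \<Longrightarrow> degree F \<le> degree Q"
    and P: "poly (map_poly of_int P) u = 0" "\<And>i. i \<ge> n \<Longrightarrow> coeff P i = 0"
  shows "\<exists>h r. P = F * h + smult (int CHAR('a)) r \<and> (\<forall>i. i + degree F \<ge> n \<longrightarrow> coeff h i = 0)"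
  using P
proof (induction n arbitrary: P)
  case 0
  then have "P = 0" by (intro poly_eqI) auto
  then show ?case by (intro exI[of _ 0]) auto
next
  case (Suc n)
  let ?p = "int CHAR('a)"
  define c where "c = coeff P n"
  have step: "\<forall>i\<ge>n. coeff (P - Q) i = 0" if "coeff Q n = c" "\<And>i. i > n \<Longrightarrow> coeff Q i = 0" for Q
    using that Suc.prems(2) by (auto simp: c_def le_eq_less_or_eq[of n] Suc_le_eq)
  show ?case
  proof (cases "n \<ge> degree F")
    case True
    let ?m = "monom c (n - degree F)"
    have "coeff (F * ?m) n = c" using True monic by (simp add: coeff_monom_mult mult.commute[of F])
    moreover have "coeff (F * ?m) i = 0" if "i > n" for i
      using that True by (simp add: coeff_monom_mult mult.commute[of F] coeff_eq_0)
    ultimately have "\<forall>i\<ge>n. coeff (P - F * ?m) i = 0" by (rule step)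
    moreover have "poly (map_poly of_int (P - F * ?m)) u = 0"
      by (simp only: poly_of_int_diff poly_of_int_mult root Suc.prems) simp
    ultimately obtain h r where hr: "P - F * ?m = F * h + smult ?p r" "\<forall>i. i + degree F \<ge> n \<longrightarrow> coeff h i = 0"
      using Suc.IH by blast
    have "P = F * (h + ?m) + smult ?p r" using hr(1) by (simp add: algebra_simps)
    moreover have "\<forall>i. i + degree F \<ge> Suc n \<longrightarrow> coeff (h + ?m) i = 0" using hr(2) True by auto
    ultimately show ?thesis by blast
  next
    case False
    have "?p dvd c"
    proof (rule ccontr)
      assume "\<not> ?p dvd c"
      then have "coprime c ?p"
        using prime_CHAR_finite_field[where 'a='a] prime_imp_coprime[of ?p c]
        by (simp add: coprime_commute)
      then obtain c' where "[c * c' = 1] (mod ?p)" using cong_solve_coprime_int by blast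
      then have "?p dvd 1 - c * c'" by (metis cong_iff_dvd_diff cong_sym)
      then have z: "(of_int (1 - c * c') :: 'a) = 0" by (simp only: of_int_eq_0_iff_char_dvd)
      \<comment> \<open>The inverse \<open>c'\<close> of \<open>c\<close> modulo \<open>p\<close>
        makes the top coefficient of \<open>Q\<close> equal to
        \<open>c * c' + (1 - c * c') = 1\<close>, and the added monomial vanishes in characteristic
        \<open>p\<close>. So \<open>Q\<close> is monic, kills \<open>u\<close> and has degree
        \<open>n\<close> below that of \<open>F\<close>.\<close>
      define Q where "Q = smult c' P + monom (1 - c * c') n"
      have "coeff Q n = 1" by (simp add: Q_def c_def)
      moreover have "degree Q \<le> n" using Suc.prems(2) by (intro degree_le) (auto simp: Q_def)
      ultimately have "degree Q = n" "lead_coeff Q = 1" using le_degree[of Q n] by auto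
      moreover have "poly (map_poly of_int Q) u = 0"
        unfolding Q_def poly_of_int_add poly_of_int_smult poly_of_int_monom Suc.prems z by simp
      ultimately show False using min[of Q] False by simp
    qed
    then obtain e where e: "c = ?p * e" by (elim dvdE)
    have "\<forall>i\<ge>n. coeff (P - monom c n) i = 0" by (rule step) auto
    moreover have "poly (map_poly of_int (P - monom c n)) u = 0"
      by (simp add: poly_of_int_diff poly_of_int_monom Suc.prems e)
    ultimately obtain h r where hr: "P - monom c n = F * h + smult ?p r" "\<forall>i. i + degree F \<ge> n \<longrightarrow> coeff h i = 0"
      using Suc.IH by blast
    have "P = F * h + smult ?p (r + monom e n)"
      using hr(1) by (simp add: algebra_simps smult_add_right smult_monom e)
    moreover have "\<forall>i. i + degree F \<ge> Suc n \<longrightarrow> coeff h i = 0" using hr(2) by auto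
    ultimately show ?thesis by blast
  qed
qed

locale gauss_chars_valuation = gauss_chars \<psi> \<omega> + valuation_ring V
  for \<psi> \<omega> :: "'a::{field,finite} \<Rightarrow> complex" and V :: "complex set"
begin

lemma unit_omega: "x \<noteq> 0 \<Longrightarrow> unit (\<omega> x)"
  using omega_root card_gt_1 by (intro unit_root_of_unity) auto

lemma unit_psi: "unit (\<psi> x)"
  using psi_root[of x] prime_gt_0_nat[OF prime_CHAR_finite_field[where 'a='a]]
  by (rule unit_root_of_unity)

lemma gauss_sum_mem: "g a \<in> V"
  unfolding gauss_sum_def by (intro sum_mem mult_mem unitD(2)[OF unit_powi] unitD(2)[OF unit_psi] unit_omega) simp

lemma jacobi_sum_mem: "jacobi_sum a b \<in> V"
  unfolding jacobi_sum_def by (intro sum_mem mult_mem unitD(2)[OF unit_powi] unit_omega) auto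

lemma poly_of_int_mem: "z \<in> V \<Longrightarrow> poly (map_poly of_int P) z \<in> V"
  by (induction P) (auto simp: poly_of_int_pCons intro: zero_mem add_mem mult_mem of_int_mem)

lemma unit_card_minus_1:
  assumes "of_nat CHAR('a) \<in> max_ideal" shows "unit (of_nat (CARD('a) - 1))"
proof -
  obtain f where f: "CARD('a) = CHAR('a) ^ f" using card_finite_field_eq_CHAR_power by blast
  then have "f > 0" using card_gt_1 by (cases f) auto
  then have "CHAR('a) dvd CARD('a)" using f by simp
  moreover have "coprime (CARD('a) - 1) CARD('a)"
    using card_gt_1 by (metis coprime_diff_one_left_nat gr_implies_not0 not_gr_zero)
  ultimately have "coprime (CARD('a) - 1) CHAR('a)" by (metis coprime_mult_right_iff dvdE)
  then show ?thesis using assms by (intro unit_of_nat_coprime)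
qed

text \<open>It suffices that the minimal monic \<open>F\<close> with root \<open>u\<close> is
  nonunit-valued at some \<open>\<omega> x\<close>. Otherwise, from
  \<open>X ^ N - 1 = F * h + p * r\<close>, all values of \<open>h\<close> at the
  \<open>N\<close>-th roots of unity are in the maximal ideal, hence so are all coefficients of
  \<open>h\<close>; comparing the coefficients of \<open>X ^ N\<close> puts 1 into the maximal
  ideal.\<close>

lemma evaluation_lift:
  assumes p: "of_nat CHAR('a) \<in> max_ideal" and u: "(u::'a) \<noteq> 0"
  obtains x :: 'a where "x \<noteq> 0"
    "\<And>P. poly (map_poly of_int P) u = 0 \<Longrightarrow> poly (map_poly of_int P) (\<omega> x) \<in> max_ideal"
proof -
  let ?N = "CARD('a) - 1"
  have N: "?N > 0" using card_gt_1 by simp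
  let ?X = "monom 1 ?N - 1 :: int poly"
  have X0: "poly (map_poly of_int ?X) u = 0"
  proof -
    have "u * u ^ ?N = u * 1" using finite_field_power_card[of u] N by (metis Suc_diff_1 card_gt_1 less_trans mult.right_neutral power_Suc zero_less_one)
    then have "u ^ ?N = 1" using u mult_left_cancel by blast
    then show ?thesis using poly_of_int_monom[of 1 0 u]
      by (simp add: poly_of_int_diff poly_of_int_monom)
  qed
  have "degree ?X \<le> ?N" using N by (intro degree_le) auto
  moreover have Xtop: "coeff ?X ?N = 1" using N by simp
  ultimately have Xmonic: "lead_coeff ?X = 1" "degree ?X = ?N" using le_degree[of ?X ?N] by auto
  obtain F :: "int poly" where F: "lead_coeff F = 1" "poly (map_poly of_int F) u = 0"
    and min: "\<And>Q. lead_coeff Q = 1 \<Longrightarrow> poly (map_poly of_int Q) u = 0 \<Longrightarrow> degree F \<le> degree Q"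
    using ex_has_least_nat[of "\<lambda>Q::int poly. lead_coeff Q = 1 \<and> poly (map_poly of_int Q) u = 0" ?X degree]
      X0 Xmonic by blast
  note div = minimal_monic_division[OF F(1,2) min]
  have dF: "degree F > 0"
  proof (rule ccontr)
    assume "\<not> degree F > 0"
    then obtain a where "F = [:a:]" using degree_0_id by (metis gr0I)
    then show False using F poly_of_int_pCons[of a 0 u] by simp
  qed
  have "\<exists>x. x \<noteq> 0 \<and> poly (map_poly of_int F) (\<omega> x) \<in> max_ideal"
  proof (rule ccontr)
    assume no: "\<not> ?thesis"
    have "\<exists>h r. ?X = F * h + smult (int CHAR('a)) r \<and> (\<forall>i. i + degree F \<ge> Suc ?N \<longrightarrow> coeff h i = 0)"
      by (rule div[OF _ _ X0]) (use N in auto)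
    then obtain h r where hr: "?X = F * h + smult (int CHAR('a)) r"
      and h0: "\<And>i. i \<ge> ?N \<Longrightarrow> coeff h i = 0" using dF by (metis Suc_leI add_mono_thms_linordered_semiring(1) add_Suc_right Nat.add_0_right)
    have poly_h: "poly (map_poly of_int h) z = (\<Sum>j<?N. of_int (coeff h j) * z ^ j)" for z :: complex
      by (rule poly_of_int_sum) (rule h0)
    have hM: "poly (map_poly of_int h) (\<omega> x) \<in> max_ideal" if x: "x \<noteq> 0" for x
    proof -
      have V: "\<omega> x \<in> V" using unit_omega[OF x] unitD by blast
      have "poly (map_poly of_int ?X) (\<omega> x) = 0"
        using omega_root[OF x] poly_of_int_monom[of 1 0 "\<omega> x"] by (simp add: poly_of_int_diff poly_of_int_monom)
      then have "poly (map_poly of_int F) (\<omega> x) * poly (map_poly of_int h) (\<omega> x) =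
          - (of_nat CHAR('a) * poly (map_poly of_int r) (\<omega> x))"
        unfolding hr poly_of_int_add poly_of_int_mult poly_of_int_smult by (simp add: eq_neg_iff_add_eq_0)
      also have "\<dots> \<in> max_ideal" using p V by (intro max_ideal_uminus max_ideal_mult' poly_of_int_mem)
      finally show ?thesis using no x V max_ideal_prime poly_of_int_mem by blast
    qed
    \<comment> \<open>Fourier inversion over the nonzero elements recovers \<open>?N\<close> times
      the \<open>i\<close>-th coefficient from the values of \<open>h\<close>. It relies on
      \<open>h\<close> having degree below \<open>?N\<close>, which \<open>degree F > 0\<close>
      provides, and on \<open>?N\<close> being a unit.\<close>
    have hi: "of_int (coeff h i) \<in> max_ideal" if i: "i < ?N" for i
    proof -
      have "(\<Sum>x\<in>U. poly (map_poly of_int h) (\<omega> x) * \<omega> x powi (- int i)) =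
          (\<Sum>x\<in>U. \<Sum>j<?N. of_int (coeff h j) * \<omega> x powi (int j - int i))"
      proof (rule sum.cong[OF refl])
        fix x assume "x \<in> U"
        then have "\<omega> x \<noteq> 0" using omega_nz by simp
        then show "poly (map_poly of_int h) (\<omega> x) * \<omega> x powi (- int i) =
            (\<Sum>j<?N. of_int (coeff h j) * \<omega> x powi (int j - int i))"
          unfolding poly_h sum_distrib_right
          by (intro sum.cong refl) (simp add: power_int_diff power_int_minus divide_inverse)
      qed
      also have "\<dots> = (\<Sum>j<?N. of_int (coeff h j) * (\<Sum>x\<in>U. \<omega> x powi (int j - int i)))"
        by (subst sum.swap) (simp add: sum_distrib_left)
      also have "\<dots> = (\<Sum>j<?N. if j = i then of_int (coeff h j) * of_nat ?N else 0)"
      proof (rule sum.cong[OF refl])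
        fix j assume j: "j \<in> {..<?N}"
        have "int ?N dvd int j - int i \<longleftrightarrow> j = i"
        proof
          assume "int ?N dvd int j - int i"
          then have "int j mod int ?N = int i mod int ?N" by (simp only: mod_eq_dvd_iff)
          then show "j = i" using i j by simp
        qed simp
        then show "of_int (coeff h j) * (\<Sum>x\<in>U. \<omega> x powi (int j - int i)) =
            (if j = i then of_int (coeff h j) * of_nat ?N else 0)"
          by (simp only: sum_omega_powi) simp
      qed
      also have "\<dots> = of_int (coeff h i) * of_nat ?N" using i by (simp del: of_nat_diff)
      finally have "of_int (coeff h i) * of_nat ?N = (\<Sum>x\<in>U. poly (map_poly of_int h) (\<omega> x) * \<omega> x powi (- int i))" ..
      also have "\<dots> \<in> max_ideal"
        using hM unit_omega by (intro max_ideal_sum max_ideal_mult' unitD(2)[OF unit_powi]) auto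
      finally show ?thesis
        using max_ideal_prime[OF of_int_mem of_nat_mem] unit_not_max_ideal[OF unit_card_minus_1[OF p]] by blast
    qed
    have "of_int (coeff h i) \<in> max_ideal" for i using hi[of i] h0[of i] zero_max_ideal by (cases "i < ?N") auto
    then have "of_int (coeff (F * h) ?N) \<in> max_ideal"
      unfolding coeff_mult of_int_sum of_int_mult by (intro max_ideal_sum max_ideal_mult of_int_mem)
    then have "of_int (coeff (F * h) ?N) + of_nat CHAR('a) * of_int (coeff r ?N) \<in> max_ideal"
      using p by (intro max_ideal_add max_ideal_mult' of_int_mem)
    moreover have "of_int (coeff ?X ?N) = of_int (coeff (F * h) ?N) + of_nat CHAR('a) * (of_int (coeff r ?N) :: complex)"
      unfolding hr by simp
    ultimately show False using Xtop one_notin_max_ideal by simp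
  qed
  then obtain x where x: "x \<noteq> 0" "poly (map_poly of_int F) (\<omega> x) \<in> max_ideal" by blast
  have "poly (map_poly of_int P) (\<omega> x) \<in> max_ideal" if P: "poly (map_poly of_int P) u = 0" for P
  proof -
    have "\<exists>h r. P = F * h + smult (int CHAR('a)) r \<and> (\<forall>i. i + degree F \<ge> Suc (degree P) \<longrightarrow> coeff h i = 0)"
      by (rule div[OF _ _ P]) (auto simp: coeff_eq_0)
    then obtain h r where hr: "P = F * h + smult (int CHAR('a)) r" by blast
    have "\<omega> x \<in> V" using unit_omega[OF x(1)] unitD by blast
    then show ?thesis
      unfolding hr poly_of_int_add poly_of_int_mult poly_of_int_smult of_int_of_nat_eq
      using x p by (intro max_ideal_add max_ideal_mult' poly_of_int_mem)
  qed
  then show ?thesis using that x(1) by blast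
qed

end

text \<open>Multiplicative on the nose and additive modulo the maximal ideal, such an \<omega>
  induces a field embedding of the finite field into the residue field of \<open>V\<close>.\<close>

locale teichmueller = gauss_chars_valuation \<psi> \<omega> V
  for \<psi> \<omega> :: "'a::{field,finite} \<Rightarrow> complex" and V +
  assumes char_max_ideal: "of_nat CHAR('a) \<in> max_ideal"
    and omega_0: "\<omega> 0 = 0"
    and omega_add: "\<omega> (x + y) \<doteq> \<omega> x + \<omega> y"

theorem (in gauss_chars_valuation) exists_teichmueller:
  assumes p: "of_nat CHAR('a) \<in> max_ideal"
  shows "\<exists>k. coprime k (CARD('a) - 1) \<and> teichmueller \<psi> (\<lambda>x. if x = 0 then 0 else \<omega> x ^ k) V"
proof -
  let ?N = "CARD('a) - 1"
  have N: "?N > 0" using card_gt_1 by simp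
  obtain u where u: "u \<noteq> 0" "\<And>x. x \<noteq> 0 \<Longrightarrow> \<exists>i. x = u ^ i" "\<And>j. \<omega> u ^ j = 1 \<longleftrightarrow> ?N dvd j"
    using omega_generator by blast
  obtain x0 where x0: "x0 \<noteq> 0"
    "\<And>P. poly (map_poly of_int P) u = 0 \<Longrightarrow> poly (map_poly of_int P) (\<omega> x0) \<in> max_ideal"
    using evaluation_lift[OF p u(1)] by blast
  obtain k where k: "x0 = u ^ k" using u(2) x0(1) by blast
  define \<theta> where "\<theta> x = (if x = 0 then 0 else \<omega> x ^ k)" for x
  have \<theta>_pow: "\<theta> (u ^ i) = \<omega> x0 ^ i" for i
    using u(1) by (simp add: \<theta>_def omega_power k mult.commute flip: power_mult)
  have \<theta>_unit: "unit (\<theta> x)" if "x \<noteq> 0" for x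
    using unit_power[OF unit_omega[OF that]] that by (simp add: \<theta>_def)
  have \<theta>_V: "\<theta> x \<in> V" for x
    using \<theta>_unit[of x] unitD(2) zero_mem by (cases "x = 0") (auto simp: \<theta>_def)
  have \<theta>_0: "\<theta> 0 = 0" by (simp add: \<theta>_def)
  have add: "\<theta> (x + y) \<doteq> \<theta> x + \<theta> y" for x y
  proof (cases "x = 0 \<or> y = 0")
    case True
    then show ?thesis using cg_refl[OF \<theta>_V] by (auto simp: \<theta>_0)
  next
    case False
    then obtain i j where ij: "x = u ^ i" "y = u ^ j" using u(2) by meson
    have "\<exists>Q. poly (map_poly of_int Q) u = x + y \<and> poly (map_poly of_int Q) (\<omega> x0) = \<theta> (x + y)"
    proof (cases "x + y = 0")
      case True
      then show ?thesis by (intro exI[of _ 0]) (simp add: \<theta>_0)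
    next
      case False
      then obtain l where "x + y = u ^ l" using u(2) by blast
      then show ?thesis by (intro exI[of _ "monom 1 l"]) (simp add: poly_of_int_monom \<theta>_pow)
    qed
    then obtain Q where Q: "poly (map_poly of_int Q) u = x + y" "poly (map_poly of_int Q) (\<omega> x0) = \<theta> (x + y)"
      by blast
    have "poly (map_poly of_int (Q - (monom 1 i + monom 1 j))) u = 0"
      unfolding poly_of_int_diff poly_of_int_add poly_of_int_monom Q by (simp add: ij)
    then have "poly (map_poly of_int (Q - (monom 1 i + monom 1 j))) (\<omega> x0) \<in> max_ideal" by (rule x0(2))
    then have "\<theta> (x + y) - (\<theta> x + \<theta> y) \<in> max_ideal"
      unfolding poly_of_int_diff poly_of_int_add poly_of_int_monom Q by (simp add: ij \<theta>_pow)
    then show ?thesis using \<theta>_V add_mem by (simp add: cg_def)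
  qed
  have order: "?N dvd k * j \<longleftrightarrow> ?N dvd j" for j
  proof
    assume "?N dvd k * j"
    then have "\<theta> (u ^ j) = 1" unfolding \<theta>_pow k using u(1,3) by (simp add: omega_power flip: power_mult)
    moreover have "\<theta> 1 = 1" by (simp add: \<theta>_def omega_1)
    \<comment> \<open>By additivity \<open>\<theta> (u ^ j) = 1\<close> puts
      \<open>\<theta> (u ^ j - 1)\<close> into the maximal ideal, while \<theta> has unit values at
      nonzero arguments. So \<theta> is injective, and passing to the \<open>k\<close>-th power does
      not lower the order.\<close>
    ultimately have "1 \<doteq> \<theta> (u ^ j - 1) + 1" using add[of "u ^ j - 1" 1] by simp
    then have "- \<theta> (u ^ j - 1) \<in> max_ideal" by (simp add: cg_def)
    then have "\<theta> (u ^ j - 1) \<in> max_ideal" using max_ideal_uminus by fastforce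
    then have "u ^ j = 1" using unit_not_max_ideal[OF \<theta>_unit, of "u ^ j - 1"] by auto
    then have "\<omega> u ^ j = 1" using omega_power[OF u(1), of j] omega_1 by simp
    then show "?N dvd j" using u(3) by simp
  qed simp
  have cop: "coprime k ?N"
  proof -
    define d where "d = gcd k ?N"
    obtain k' N' where kN: "k = d * k'" "?N = d * N'" unfolding d_def by (meson dvdE gcd_dvd1 gcd_dvd2)
    have "k * N' = ?N * k'" by (simp only: kN mult_ac)
    then have "?N dvd N'" using order[of N'] by simp
    then have "d * N' dvd 1 * N'" by (simp only: kN mult_1)
    moreover have "N' \<noteq> 0" using kN N by (intro notI) simp
    ultimately have "d = 1" by simp
    then show ?thesis by (simp add: d_def coprime_iff_gcd_eq_1)
  qed
  have "gauss_chars \<psi> \<theta>"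
  proof
    show "\<theta> (x * y) = \<theta> x * \<theta> y" if "x \<noteq> 0" "y \<noteq> 0" for x y
      using that by (simp add: \<theta>_def omega_mult power_mult_distrib)
    fix j
    have "(\<forall>x. x \<noteq> 0 \<longrightarrow> \<theta> x ^ j = 1) \<longleftrightarrow> (\<forall>x. x \<noteq> 0 \<longrightarrow> \<omega> x ^ (k * j) = 1)"
      by (auto simp: \<theta>_def power_mult)
    then show "(\<forall>x. x \<noteq> 0 \<longrightarrow> \<theta> x ^ j = 1) \<longleftrightarrow> ?N dvd j"
      using omega_order[of "k * j"] order[of j] by simp
  qed (use psi_add psi_nz psi_nontriv omega_nz in \<open>auto simp: \<theta>_def\<close>)
  then interpret \<theta>: gauss_chars \<psi> \<theta> .
  interpret \<theta>: gauss_chars_valuation \<psi> \<theta> V ..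
  have "teichmueller \<psi> \<theta> V"
    by unfold_locales (use p \<theta>_0 add in auto)
  then show ?thesis using cop unfolding \<theta>_def by blast
qed

section \<open>Digit sums\<close>

text \<open>For \<open>0 \<le> s < p\<^sup>f - 1\<close>, this is the sum of the base-\<open>p\<close> digits of \<open>s\<close> divided by \<open>p - 1\<close>.\<close>

definition digit_frac_sum :: "nat \<Rightarrow> nat \<Rightarrow> int \<Rightarrow> real" where
  "digit_frac_sum p f s = (\<Sum>j<f. frac (real p ^ j * of_int s / (real p ^ f - 1)))"

lemma frac_add_of_int: "frac (x + of_int n) = frac (x::real)"
  by (simp add: frac_def)

lemma digit_frac_sum_period:
  assumes p: "p > 1" and f: "f > 0" and d: "int (p ^ f - 1) dvd s - s'"
  shows "digit_frac_sum p f s = digit_frac_sum p f s'"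
proof -
  obtain k where k: "s = s' + int (p ^ f - 1) * k" using d by (metis dvdE diff_eq_eq add.commute)
  have pf: "p ^ f > 1" using p f by (rule one_less_power)
  have N: "real p ^ f - 1 = of_int (int (p ^ f - 1))" "real p ^ f - 1 > 0"
    using pf p f by (simp_all add: of_nat_diff)
  have "real p ^ j * of_int s / (real p ^ f - 1) = real p ^ j * of_int s' / (real p ^ f - 1) + of_int (int p ^ j * k)" for j
  proof -
    have "of_int s = of_int s' + (real p ^ f - 1) * of_int k" unfolding k N(1) by simp
    then show ?thesis using N(2) by (simp only:) (simp add: field_simps)
  qed
  then show ?thesis unfolding digit_frac_sum_def by (simp only: frac_add_of_int)
qed

text \<open>Multiplication by \<open>p\<close> rotates the digits: the new summand for
  \<open>j = f\<close> agrees with the old one for \<open>j = 0\<close>, because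
  \<open>p ^ f\<close> is 1 modulo \<open>p ^ f - 1\<close>.\<close>

lemma digit_frac_sum_mult:
  assumes "p > 1" "f > 0" shows "digit_frac_sum p f (int p * s) = digit_frac_sum p f s"
proof -
  let ?h = "\<lambda>j. frac (real p ^ j * of_int s / (real p ^ f - 1))"
  have N: "real p ^ f - 1 > 0" using assms by (simp add: one_less_power)
  have "real p ^ f * of_int s / (real p ^ f - 1) = of_int s / (real p ^ f - 1) + of_int s"
    using N by (simp add: field_simps)
  then have hf: "?h f = ?h 0" by (simp only: frac_add_of_int) simp
  have "digit_frac_sum p f (int p * s) = (\<Sum>j<f. ?h (Suc j))"
    unfolding digit_frac_sum_def by (simp add: mult_ac)
  also have "\<dots> = (\<Sum>j<Suc f. ?h j) - ?h 0" by (subst sum.lessThan_Suc_shift) simp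
  also have "\<dots> = (\<Sum>j<f. ?h j)" using hf by simp
  finally show ?thesis by (simp add: digit_frac_sum_def)
qed

text \<open>Each pair of fractional parts adds up to 1, since none of the arguments is an integer:
  \<open>p ^ j\<close> is prime to \<open>p ^ f - 1\<close>.\<close>

lemma digit_frac_sum_uminus:
  assumes p: "p > 1" and f: "f > 0" and s: "\<not> int (p ^ f - 1) dvd s"
  shows "digit_frac_sum p f s + digit_frac_sum p f (- s) = real f"
proof -
  have pf: "p ^ f > 1" using p f by (rule one_less_power)
  have N: "real p ^ f - 1 = of_int (int (p ^ f - 1))" "real p ^ f - 1 > 0"
    using pf p f by (simp_all add: of_nat_diff)
  have "frac (real p ^ j * of_int s / (real p ^ f - 1)) + frac (real p ^ j * of_int (- s) / (real p ^ f - 1)) = 1" for j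
  proof -
    have "real p ^ j * of_int s / (real p ^ f - 1) \<notin> \<int>"
    proof
      assume "real p ^ j * of_int s / (real p ^ f - 1) \<in> \<int>"
      then obtain k where "real p ^ j * of_int s / (real p ^ f - 1) = of_int k" by (elim Ints_cases)
      then have "real p ^ j * of_int s = of_int k * (real p ^ f - 1)" using N(2) by (simp add: field_simps)
      then have "of_int (int p ^ j * s) = (of_int (k * int (p ^ f - 1)) :: real)" by (simp add: N)
      then have "int p ^ j * s = k * int (p ^ f - 1)" by (simp only: of_int_eq_iff)
      then have "int (p ^ f - 1) dvd int (p ^ j) * s" by (metis dvd_triv_right of_nat_power)
      moreover have "coprime (p ^ f - 1) (p ^ f)"
        using pf by (metis coprime_diff_one_left_nat gr_implies_not0 not_gr_zero)
      then have "coprime (p ^ f - 1) (p ^ j)" using f by (simp add: coprime_power_right_iff)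
      then have "coprime (int (p ^ f - 1)) (int (p ^ j))" by (simp only: coprime_int_iff)
      ultimately show False using s coprime_dvd_mult_right_iff by blast
    qed
    then show ?thesis by (simp add: frac_neg)
  qed
  then have "(\<Sum>j<f. frac (real p ^ j * of_int s / (real p ^ f - 1)) + frac (real p ^ j * of_int (- s) / (real p ^ f - 1))) = real f"
    by simp
  then show ?thesis unfolding digit_frac_sum_def by (simp only: sum.distrib)
qed

lemma digit_frac_sum_0: "digit_frac_sum p f 0 = 0"
  by (simp add: digit_frac_sum_def)

text \<open>Multiplication by \<open>p ^ j\<close> modulo \<open>p ^ f - 1\<close> rotates the
  digits, so the upper block \<open>a\<close> becomes the lower one and \<open>b\<close> moves up by
  \<open>j\<close> places.\<close>

lemma frac_digit_shift:
  fixes p f j a b :: nat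
  assumes p: "p > 1" and j: "j < f" and a: "a < p ^ j" and b: "b < p ^ (f - j)"
    and lt: "a * p ^ (f - j) + b < p ^ f - 1"
  shows "frac (real p ^ j * real (a * p ^ (f - j) + b) / (real p ^ f - 1)) = (real a + real p ^ j * real b) / (real p ^ f - 1)"
proof -
  have pf: "p ^ f = p ^ j * p ^ (f - j)" using j by (simp flip: power_add)
  have pf1: "p ^ f > 1" using p j by (intro one_less_power) auto
  have N0: "real p ^ f - 1 > 0" using p j by (simp add: one_less_power)
  have "real p ^ j * real (a * p ^ (f - j) + b) = real a * real (p ^ j * p ^ (f - j)) + real p ^ j * real b"
    by (simp add: algebra_simps)
  also have "real (p ^ j * p ^ (f - j)) = (real p ^ f - 1) + 1" by (simp flip: pf)
  finally have "real p ^ j * real (a * p ^ (f - j) + b) / (real p ^ f - 1) =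
      (real a + real p ^ j * real b) / (real p ^ f - 1) + of_int (int a)"
    using N0 by (simp add: field_simps)
  then have "frac (real p ^ j * real (a * p ^ (f - j) + b) / (real p ^ f - 1)) =
      frac ((real a + real p ^ j * real b) / (real p ^ f - 1))"
    by (simp only: frac_add_of_int)
  also have "\<dots> = (real a + real p ^ j * real b) / (real p ^ f - 1)"
  proof -
    have "a + p ^ j * b < p ^ f - 1"
    \<comment> \<open>The rotated number could reach \<open>p ^ f - 1\<close> only with all digits
      equal to \<open>p - 1\<close>, which \<open>lt\<close> excludes: a maximal \<open>b\<close>
      forces \<open>Suc a < p ^ j\<close>.\<close>
    proof (cases "Suc b = p ^ (f - j)")
      case True
      then have "a * p ^ (f - j) + p ^ (f - j) < p ^ f" using lt pf1 by linarith
      then have "Suc a * p ^ (f - j) < p ^ j * p ^ (f - j)" unfolding pf by simp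
      then have "Suc a < p ^ j" using mult_less_cancel2 by blast
      moreover have "p ^ j * b + p ^ j = p ^ f" unfolding pf True[symmetric] by simp
      ultimately show ?thesis by linarith
    next
      case False
      then have "Suc (Suc b) \<le> p ^ (f - j)" using b by simp
      then have "p ^ j * Suc (Suc b) \<le> p ^ f" unfolding pf by (rule mult_left_mono) simp
      moreover have "p ^ j \<ge> 1" using p by simp
      ultimately show ?thesis using a by (simp add: algebra_simps)
    qed
    then have "real (a + p ^ j * b) < real (p ^ f - 1)" by (simp only: of_nat_less_iff)
    then have "real a + real p ^ j * real b < real p ^ f - 1" using pf1 by (simp add: of_nat_diff)
    then show ?thesis using N0 by (subst frac_eq) auto
  qed
  finally show ?thesis .
qed

text \<open>The last digit of \<open>Suc s\<close> is nonzero, so adding 1 to \<open>s\<close>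
  carries nothing: in each rotation \<open>a\<close> stays and \<open>b\<close> grows by one. The
  increments form a geometric series with sum \<open>1 / (p - 1)\<close>.\<close>

lemma digit_frac_sum_Suc:
  fixes p f s :: nat
  assumes p: "p > 1" and f: "f > 0" and s: "Suc s < p ^ f - 1" and nd: "\<not> p dvd Suc s"
  shows "digit_frac_sum p f (int (Suc s)) = digit_frac_sum p f (int s) + 1 / (real p - 1)"
proof -
  have N0: "real p ^ f - 1 > 0" using p f by (simp add: one_less_power)
  have "frac (real p ^ j * real (Suc s) / (real p ^ f - 1)) =
      frac (real p ^ j * real s / (real p ^ f - 1)) + real p ^ j / (real p ^ f - 1)" if j: "j < f" for j
  proof -
    let ?M = "p ^ (f - j)"
    define a b where "a = Suc s div ?M" "b = Suc s mod ?M"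
    have ab: "Suc s = a * ?M + b" by (simp only: a_b_def div_mult_mod_eq)
    have M: "?M > 0" using p by simp
    have pf: "p ^ f = p ^ j * ?M" using j by (simp flip: power_add)
    have "Suc s < p ^ j * ?M" using s unfolding pf by linarith
    then have a: "a < p ^ j" unfolding a_b_def by (simp add: less_mult_imp_div_less)
    have b: "b < ?M" using M by (simp add: a_b_def)
    have "b \<noteq> 0"
    proof
      assume "b = 0"
      then have "?M dvd Suc s" by (simp add: a_b_def mod_eq_0_iff_dvd)
      moreover have "p dvd ?M" using j by (simp add: dvd_power)
      ultimately show False using nd dvd_trans by blast
    qed
    then obtain b' where b': "b = Suc b'" by (cases b) auto
    have s': "s = a * ?M + b'" using ab b' by simp
    have "frac (real p ^ j * real (Suc s) / (real p ^ f - 1)) = (real a + real p ^ j * real b) / (real p ^ f - 1)"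
      unfolding ab by (rule frac_digit_shift[OF p j a b]) (use s ab in linarith)
    moreover have "frac (real p ^ j * real s / (real p ^ f - 1)) = (real a + real p ^ j * real b') / (real p ^ f - 1)"
      unfolding s' by (rule frac_digit_shift[OF p j a]) (use b b' s s' in linarith)+
    ultimately show ?thesis by (simp add: b' add_divide_distrib distrib_left)
  qed
  then have "digit_frac_sum p f (int (Suc s)) = digit_frac_sum p f (int s) + (\<Sum>j<f. real p ^ j / (real p ^ f - 1))"
    unfolding digit_frac_sum_def sum.distrib[symmetric] by (intro sum.cong) auto
  also have "(\<Sum>j<f. real p ^ j / (real p ^ f - 1)) = 1 / (real p - 1)"
  proof -
    have "(real p - 1) * (\<Sum>j<f. real p ^ j) = real p ^ f - 1" by (simp add: power_diff_1_eq)
    then show ?thesis using N0 p by (simp add: field_simps flip: sum_divide_distrib)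
  qed
  finally show ?thesis .
qed

section \<open>The trace and the standard additive character\<close>

definition field_trace :: "nat \<Rightarrow> 'a::{field,finite} \<Rightarrow> 'a" where
  "field_trace f x = (\<Sum>j<f. x ^ (CHAR('a) ^ j))"

text \<open>A natural number standing for the trace, to serve as an exponent of a
  \<open>p\<close>-th root of unity. It exists because the trace lies in the prime field; depending
  on the trace alone, it is invariant under Frobenius.\<close>

definition nat_trace :: "nat \<Rightarrow> 'a::{field,finite} \<Rightarrow> nat" where
  "nat_trace f x = (LEAST n. of_nat n = field_trace f x)"

lemma field_trace_add: "field_trace f (x + y) = field_trace f x + field_trace f y"
  unfolding field_trace_def sum.distrib[symmetric]
  by (rule sum.cong[OF refl], rule freshmans_dream'[OF prime_CHAR_finite_field refl])

lemma field_trace_power_CHAR: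
  fixes x :: "'a::{field,finite}"
  assumes "CARD('a) = CHAR('a) ^ f"
  shows "field_trace f (x ^ CHAR('a)) = field_trace f x" "field_trace f x ^ CHAR('a) = field_trace f x"
proof -
  let ?h = "\<lambda>j. x ^ (CHAR('a) ^ j)"
  have "field_trace f (x ^ CHAR('a)) = (\<Sum>j<f. ?h (Suc j))"
    by (simp add: field_trace_def flip: power_mult)
  also have "\<dots> = (\<Sum>j<Suc f. ?h j) - ?h 0" by (subst sum.lessThan_Suc_shift) simp
  also have "\<dots> = (\<Sum>j<f. ?h j)" using finite_field_power_card[of x] by (simp add: assms)
  finally show 1: "field_trace f (x ^ CHAR('a)) = field_trace f x" by (simp add: field_trace_def)
  have "field_trace f x ^ CHAR('a) = (\<Sum>j<f. ?h j ^ CHAR('a))"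
    unfolding field_trace_def by (rule freshmans_dream_sum[OF prime_CHAR_finite_field refl])
  also have "\<dots> = field_trace f (x ^ CHAR('a))"
    unfolding field_trace_def by (simp add: mult.commute flip: power_mult)
  finally show "field_trace f x ^ CHAR('a) = field_trace f x" using 1 by simp
qed

lemma of_nat_power_CHAR: "(of_nat n :: 'a::{field,finite}) ^ CHAR('a) = of_nat n"
proof (induction n)
  case (Suc n)
  then show ?case using freshmans_dream[OF prime_CHAR_finite_field refl, of "1::'a" "of_nat n"] by simp
qed (simp add: power_0_left prime_gt_0_nat[OF prime_CHAR_finite_field])

text \<open>The \<open>p\<close> images of the naturals below \<open>p\<close> already exhaust the
  roots of \<open>X ^ p - X\<close>.\<close>

lemma fixed_by_frobenius_imp_of_nat:
  fixes x :: "'a::{field,finite}"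
  assumes "x ^ CHAR('a) = x" shows "\<exists>n. x = of_nat n"
proof -
  let ?p = "CHAR('a)"
  have p: "prime ?p" by (rule prime_CHAR_finite_field)
  define P :: "'a poly" where "P = monom 1 ?p - [:0, 1:]"
  have p1: "?p > 1" using p prime_gt_1_nat by blast
  have "coeff P ?p = 1" using p1 by (auto simp: P_def coeff_pCons split: nat.split)
  then have P0: "P \<noteq> 0" by auto
  have "degree P \<le> ?p" using p1 by (intro degree_le) (auto simp: P_def coeff_pCons split: nat.split)
  have roots: "{y. poly P y = 0} = {y. y ^ ?p = y}" by (auto simp: P_def poly_monom)
  have inj: "inj_on (of_nat :: nat \<Rightarrow> 'a) {..<?p}"
    by (rule inj_onI) (auto simp: of_nat_eq_iff_cong_CHAR cong_def)
  have "of_nat ` {..<?p} = {y::'a. y ^ ?p = y}"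
  proof (rule card_seteq)
    show "of_nat ` {..<?p} \<subseteq> {y::'a. y ^ ?p = y}" using of_nat_power_CHAR by auto
    have "card {y::'a. y ^ ?p = y} \<le> degree P" using card_poly_roots_bound[OF P0] roots by simp
    then show "card {y::'a. y ^ ?p = y} \<le> card (of_nat ` {..<?p} :: 'a set)"
      using \<open>degree P \<le> ?p\<close> card_image[OF inj] by simp
  qed simp
  then show ?thesis using assms by blast
qed

lemma of_nat_nat_trace:
  fixes x :: "'a::{field,finite}"
  assumes "CARD('a) = CHAR('a) ^ f"
  shows "of_nat (nat_trace f x) = field_trace f x"
proof -
  obtain n where "of_nat n = field_trace f x"
    using fixed_by_frobenius_imp_of_nat[OF field_trace_power_CHAR(2)[OF assms, of x]] by metis
  then show ?thesis unfolding nat_trace_def by (rule LeastI)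
qed

text \<open>As a polynomial the trace has degree at most \<open>p ^ (f - 1)\<close>, less than the
  number of field elements, and its coefficient at \<open>X\<close> is 1; so it cannot vanish
  everywhere.\<close>

lemma field_trace_nontrivial:
  assumes card: "CARD('a::{field,finite}) = CHAR('a) ^ f" and f: "f > 0"
  shows "\<exists>x::'a. field_trace f x \<noteq> 0"
proof (rule ccontr)
  assume "\<not> ?thesis"
  then have z: "field_trace f x = 0" for x :: 'a by blast
  let ?p = "CHAR('a)"
  have p1: "?p > 1" using prime_CHAR_finite_field[where 'a='a] prime_gt_1_nat by blast
  define P :: "'a poly" where "P = (\<Sum>j<f. monom 1 (?p ^ j))"
  have "coeff P 1 = (\<Sum>j<f. if j = 0 then 1 else 0)"
    unfolding P_def coeff_sum using p1 by (intro sum.cong) (auto simp: power_eq_1_iff)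
  then have P0: "P \<noteq> 0" using f by auto
  have "degree P \<le> ?p ^ (f - 1)"
  proof (rule degree_le, intro allI impI)
    fix i assume i: "?p ^ (f - 1) < i"
    have "?p ^ j \<noteq> i" if "j < f" for j
    proof -
      have "?p ^ j \<le> ?p ^ (f - 1)" using that p1 by (intro power_increasing) auto
      then show ?thesis using i by simp
    qed
    then show "coeff P i = 0" by (auto simp: P_def coeff_sum intro!: sum.neutral)
  qed
  also have "?p ^ (f - 1) < ?p ^ f" using p1 f by (intro power_strict_increasing) auto
  finally have "degree P < CARD('a)" using card by simp
  moreover have "poly P x = 0" for x using z[of x] by (simp add: P_def poly_sum poly_monom field_trace_def)
  then have "{x. poly P x = 0} = UNIV" by auto
  ultimately show False using card_poly_roots_bound[OF P0] by simp
qed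

lemma frobenius_bij: "bij (\<lambda>x::'a::{field,finite}. x ^ CHAR('a))"
proof -
  let ?p = "CHAR('a)"
  have "inj (\<lambda>x::'a. x ^ ?p)"
  proof (rule injI)
    fix x y :: 'a assume "x ^ ?p = y ^ ?p"
    moreover have "((x - y) + y) ^ ?p = (x - y) ^ ?p + y ^ ?p"
      by (rule freshmans_dream[OF prime_CHAR_finite_field refl])
    ultimately have "(x - y) ^ ?p = 0" by simp
    then show "x = y" by simp
  qed
  then show ?thesis by (simp add: bij_def finite_UNIV_inj_surj)
qed

lemma root_of_unity_power_cong:
  assumes "(z::'b::monoid_mult) ^ p = 1" "[m = n] (mod p)" shows "z ^ m = z ^ n"
proof -
  have "z ^ k = z ^ (k mod p)" for k
  proof -
    have "z ^ k = z ^ (p * (k div p) + k mod p)" by simp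
    then show ?thesis by (simp only: power_add power_mult assms(1)) simp
  qed
  then show ?thesis using assms(2) by (metis cong_def)
qed

lemma standard_additive_character:
  fixes z :: complex
  assumes card: "CARD('a::{field,finite}) = CHAR('a) ^ f" and z: "z ^ CHAR('a) = 1"
  shows "z ^ nat_trace f (x + y) = z ^ nat_trace f (x::'a) * z ^ nat_trace f y"
proof -
  have "(of_nat (nat_trace f (x + y)) :: 'a) = of_nat (nat_trace f x + nat_trace f y)"
    by (simp add: of_nat_nat_trace[OF card] field_trace_add)
  then have "[nat_trace f (x + y) = nat_trace f x + nat_trace f y] (mod CHAR('a))"
    by (simp only: of_nat_eq_iff_cong_CHAR)
  then have "z ^ nat_trace f (x + y) = z ^ (nat_trace f x + nat_trace f y)"
    by (rule root_of_unity_power_cong[OF z])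
  then show ?thesis by (simp add: power_add)
qed

lemma standard_additive_character_nontrivial:
  fixes z :: complex
  assumes card: "CARD('a::{field,finite}) = CHAR('a) ^ f" "f > 0" and z: "z ^ CHAR('a) = 1" "z \<noteq> 1"
  shows "\<exists>x::'a. z ^ nat_trace f x \<noteq> 1"
proof -
  let ?p = "CHAR('a)"
  obtain x :: 'a where x: "field_trace f x \<noteq> 0" using field_trace_nontrivial[OF card] by blast
  let ?n = "nat_trace f x"
  have "\<not> ?p dvd ?n" using x of_nat_nat_trace[OF card(1), of x] by (metis of_nat_eq_0_iff_char_dvd)
  then have "coprime ?n ?p" using prime_CHAR_finite_field[where 'a='a] prime_imp_coprime coprime_commute by blast
  then obtain m where "[?n * m = Suc 0] (mod ?p)" using cong_solve_coprime_nat by blast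
  then have "z ^ (?n * m) = z ^ Suc 0" by (rule root_of_unity_power_cong[OF z(1)])
  then have "(z ^ ?n) ^ m = z" by (simp add: power_mult)
  then have "z ^ ?n \<noteq> 1" using z(2) by (intro notI) simp
  then show ?thesis by blast
qed

section \<open>The element \<open>z - 1\<close> for a nontrivial \<open>p\<close>-th root of unity
  \<open>z\<close>\<close>

context valuation_ring
begin

lemma cg_geometric_sum:
  assumes z: "z - 1 \<in> max_ideal" shows "(\<Sum>i<n. z ^ i) \<doteq> of_nat n"
proof -
  have "z = (z - 1) + 1" by simp
  then have "z \<in> V" using add_mem[OF max_ideal_subset[OF z] one_mem] by metis
  then have "z \<doteq> 1" using z one_mem by (simp add: cg_def)
  then have "(\<Sum>i<n. z ^ i) \<doteq> (\<Sum>i<n. 1 ^ i)" by (intro cg_sum cg_power)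
  then show ?thesis by simp
qed

text \<open>With \<open>w = z - 1\<close>, expanding \<open>(w + 1) ^ p = 1\<close> and cancelling
  \<open>w\<close> leaves \<open>w ^ (p - 1) = - S * p\<close>. This first puts \<open>w\<close>
  into the maximal ideal; then \<open>S\<close> is congruent to its constant term
  \<open>(p choose 1) div p = 1\<close>, hence a unit.\<close>

lemma unit_prime_div_power:
  fixes z :: 'b
  assumes p: "prime p" "of_nat p \<in> max_ideal" and z: "z ^ p = 1" "z \<noteq> 1"
  shows "z - 1 \<in> max_ideal" "\<exists>e. unit e \<and> (z - 1) ^ (p - 1) = e * of_nat p"
proof -
  define w where "w = z - 1"
  have p1: "p > 1" using p prime_gt_1_nat by blast
  have w0: "w \<noteq> 0" using z by (simp add: w_def)
  have wV: "w \<in> V" unfolding w_def using unit_root_of_unity[OF z(1)] p1 by (intro diff_mem one_mem unitD(2)) auto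
  define c where "c k = (p choose k) div p" for k
  have c: "p choose k = p * c k" if "0 < k" "k < p" for k
    using dvd_choose_prime[of k p] that p by (auto simp: c_def)
  define S where "S = (\<Sum>k<p - 1. of_nat (c (Suc k)) * w ^ k)"
  have SV: "S \<in> V" unfolding S_def by (intro sum_mem mult_mem of_nat_mem power_mem wV)
  have "1 = (w + 1) ^ p" using z by (simp add: w_def)
  also have "\<dots> = (\<Sum>k\<le>p. of_nat (p choose k) * w ^ k)" by (subst binomial_ring) simp
  also have "\<dots> = (\<Sum>k<Suc p. of_nat (p choose k) * w ^ k)" by (simp only: lessThan_Suc_atMost)
  also have "\<dots> = (\<Sum>k<p. of_nat (p choose k) * w ^ k) + w ^ p" by simp
  also have "(\<Sum>k<p. of_nat (p choose k) * w ^ k) = (\<Sum>k<Suc (p - 1). of_nat (p choose k) * w ^ k)" using p1 by simp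
  also have "\<dots> = 1 + (\<Sum>k<p - 1. of_nat (p choose Suc k) * w ^ Suc k)"
    by (subst sum.lessThan_Suc_shift) simp
  also have "(\<Sum>k<p - 1. of_nat (p choose Suc k) * w ^ Suc k) = of_nat p * w * S"
    unfolding S_def sum_distrib_left
    by (intro sum.cong refl) (auto simp: c mult_ac)
  finally have eq: "w ^ p + of_nat p * w * S = 0" by (simp add: algebra_simps)
  moreover have "w ^ p = w * w ^ (p - 1)" using p1 by (metis power_eq_if not_one_less_zero)
  ultimately have "w * (w ^ (p - 1) + of_nat p * S) = 0" by (simp add: algebra_simps)
  then have "w ^ (p - 1) + of_nat p * S = 0" using w0 by (metis mult_eq_0_iff)
  then have pw: "w ^ (p - 1) = - S * of_nat p" by (simp add: eq_neg_iff_add_eq_0 mult.commute)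
  have "w ^ (p - 1) \<in> max_ideal" unfolding pw using SV p by (intro max_ideal_mult uminus_mem)
  then have wM: "w \<in> max_ideal" by (rule max_ideal_of_power[OF wV])
  then show "z - 1 \<in> max_ideal" by (simp add: w_def)
  have "S = of_nat (c 1) + (\<Sum>k<p - 2. of_nat (c (Suc (Suc k))) * w ^ Suc k)"
  proof -
    have "p - 1 = Suc (p - 2)" using p1 by simp
    then show ?thesis unfolding S_def by (simp only: sum.lessThan_Suc_shift) simp
  qed
  moreover have "c 1 = 1" using p1 by (simp add: c_def)
  moreover have "(\<Sum>k<p - 2. of_nat (c (Suc (Suc k))) * w ^ Suc k) \<in> max_ideal"
    using wM wV unfolding power_Suc by (intro max_ideal_sum max_ideal_mult max_ideal_mult' of_nat_mem power_mem)
  ultimately have "S \<doteq> 1" using SV one_mem by (simp add: cg_def)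
  then have "unit S" using unit_cg[OF unit_one cg_sym] by blast
  then show "\<exists>e. unit e \<and> (z - 1) ^ (p - 1) = e * of_nat p"
    using pw unit_uminus w_def by blast
qed

end

section \<open>Stickelberger's theorem\<close>

text \<open>The normalised situation: a Teichmueller \<omega> and the standard additive character.
  \<open>gauss_sum_valuation_at_p\<close> reduces arbitrary \<psi> and \<omega> to it.\<close>

locale stickelberger = teichmueller \<psi> \<omega> V
  for \<psi> \<omega> :: "'a::{field,finite} \<Rightarrow> complex" and V +
  fixes f :: nat and z :: complex
  assumes card_eq: "CARD('a) = CHAR('a) ^ f"
    and z_root: "z ^ CHAR('a) = 1" and z_ne_1: "z \<noteq> 1"
    and psi_eq: "\<psi> x = z ^ nat_trace f x"
begin

lemma CHAR_gt_1: "CHAR('a) > 1"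
  using prime_CHAR_finite_field[where 'a='a] prime_gt_1_nat by blast

lemma f_pos: "f > 0"
  using card_eq card_gt_1 by (cases f) auto

lemma z_minus_1_max_ideal: "z - 1 \<in> max_ideal"
  using unit_prime_div_power(1)[OF prime_CHAR_finite_field char_max_ideal z_root z_ne_1] .

lemma z_minus_1_power:
  obtains e where "unit e" "(z - 1) ^ ((CHAR('a) - 1) * f) = e * of_nat CARD('a)"
proof -
  obtain e where e: "unit e" "(z - 1) ^ (CHAR('a) - 1) = e * of_nat CHAR('a)"
    using unit_prime_div_power(2)[OF prime_CHAR_finite_field char_max_ideal z_root z_ne_1] by blast
  have "(z - 1) ^ ((CHAR('a) - 1) * f) = (e * of_nat CHAR('a)) ^ f"
    by (simp only: power_mult e(2))
  also have "\<dots> = e ^ f * of_nat CARD('a)" by (simp add: power_mult_distrib card_eq)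
  finally show ?thesis using that unit_power[OF e(1)] by blast
qed

lemma omega_mem: "\<omega> x \<in> V"
  using unitD(2)[OF unit_omega] zero_mem omega_0 by (cases "x = 0") auto

lemma omega_of_nat: "\<omega> (of_nat n) \<doteq> of_nat n"
proof (induction n)
  case 0
  then show ?case using cg_refl[OF zero_mem] by (simp add: omega_0)
next
  case (Suc n)
  have "\<omega> (1 + of_nat n) \<doteq> \<omega> 1 + \<omega> (of_nat n)" by (rule omega_add)
  also have "\<dots> \<doteq> 1 + of_nat n" unfolding omega_1 by (intro cg_add cg_refl one_mem Suc)
  finally show ?case by simp
qed

lemma omega_sum: "finite I \<Longrightarrow> \<omega> (sum h I) \<doteq> (\<Sum>i\<in>I. \<omega> (h i))"
proof (induction I rule: finite_induct)
  case empty
  then show ?case using cg_refl[OF zero_mem] by (simp add: omega_0)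
next
  case (insert i I)
  have "\<omega> (h i + sum h I) \<doteq> \<omega> (h i) + \<omega> (sum h I)" by (rule omega_add)
  also have "\<dots> \<doteq> \<omega> (h i) + (\<Sum>i\<in>I. \<omega> (h i))" using insert by (intro cg_add cg_refl omega_mem)
  finally show ?case using insert by simp
qed

lemma nat_trace_cg:
  assumes "x \<noteq> 0" shows "of_nat (nat_trace f x) \<doteq> (\<Sum>j<f. \<omega> x ^ (CHAR('a) ^ j))"
proof -
  have "of_nat (nat_trace f x) \<doteq> \<omega> (of_nat (nat_trace f x))" by (rule cg_sym[OF omega_of_nat])
  also have "\<omega> (of_nat (nat_trace f x)) = \<omega> (\<Sum>j<f. x ^ (CHAR('a) ^ j))"
    by (simp only: of_nat_nat_trace[OF card_eq] field_trace_def)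
  also have "\<dots> \<doteq> (\<Sum>j<f. \<omega> (x ^ (CHAR('a) ^ j)))" by (rule omega_sum) simp
  finally show ?thesis using assms by (simp add: omega_power)
qed

text \<open>Frobenius permutes the nonzero elements and preserves the trace, hence \<psi>. This is
  the counterpart of the digit rotation in \<open>digit_frac_sum_mult\<close>.\<close>

lemma gauss_sum_frobenius: "g (int CHAR('a) * a) = g a"
proof -
  have "g (int CHAR('a) * a) = (\<Sum>x\<in>U. \<omega> (x ^ CHAR('a)) powi a * \<psi> (x ^ CHAR('a)))"
    unfolding gauss_sum_def
  proof (rule sum.cong[OF refl])
    fix x :: 'a assume "x \<in> U"
    moreover have "nat_trace f (x ^ CHAR('a)) = nat_trace f x"
      by (simp only: nat_trace_def field_trace_power_CHAR(1)[OF card_eq])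
    ultimately show "\<omega> x powi (int CHAR('a) * a) * \<psi> x = \<omega> (x ^ CHAR('a)) powi a * \<psi> (x ^ CHAR('a))"
      by (simp add: omega_power psi_eq power_int_mult)
  qed
  also have "\<dots> = g a"
    unfolding gauss_sum_def
  proof (rule sum.reindex_bij_betw)
    have "inj_on (\<lambda>x::'a. x ^ CHAR('a)) U" using frobenius_bij[where 'a='a] bij_is_inj inj_on_subset by blast
    moreover have "(\<lambda>x::'a. x ^ CHAR('a)) ` U = U"
    proof
      show "U \<subseteq> (\<lambda>x::'a. x ^ CHAR('a)) ` U"
      proof
        fix y :: 'a assume "y \<in> U"
        moreover obtain x where "y = x ^ CHAR('a)" using frobenius_bij[where 'a='a] by (metis bij_pointE)
        ultimately show "y \<in> (\<lambda>x::'a. x ^ CHAR('a)) ` U" using CHAR_gt_1 by (auto simp: power_0_left)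
      qed
    qed auto
    ultimately show "bij_betw (\<lambda>x::'a. x ^ CHAR('a)) U U" by (simp add: bij_betw_def)
  qed
  finally show ?thesis .
qed

text \<open>For \<open>q > 2\<close> the values \<open>\<omega> x powi (- 1)\<close> sum to zero, so
  \<psi> may be replaced by \<open>\<psi> x - 1\<close>, which has the factor \<open>z - 1\<close>.
  The cofactor is congruent to the trace, a sum of \<open>\<omega> x ^ (p ^ j)\<close>, and
  orthogonality keeps only \<open>j = 0\<close>; so \<open>S\<close> is congruent to the unit
  \<open>q - 1\<close>.\<close>

lemma gauss_sum_minus_1:
  assumes "CARD('a) > 2"
  obtains e where "unit e" "g (- 1) = (z - 1) * e"
proof -
  let ?N = "CARD('a) - 1"
  define S where "S = (\<Sum>x\<in>U. \<omega> x powi (- 1) * (\<Sum>i<nat_trace f x. z ^ i))"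
  have nd: "\<not> int ?N dvd - 1" using assms by (simp add: zdvd_not_zless)
  have "g (- 1) = (\<Sum>x\<in>U. \<omega> x powi (- 1) * (\<psi> x - 1)) + (\<Sum>x\<in>U. \<omega> x powi (- 1))"
    unfolding gauss_sum_def sum.distrib[symmetric] by (intro sum.cong) (auto simp: algebra_simps)
  also have "(\<Sum>x\<in>U. \<omega> x powi (- 1)) = 0" using nd by (simp only: sum_omega_powi if_False)
  also have "(\<Sum>x\<in>U. \<omega> x powi (- 1) * (\<psi> x - 1)) = (z - 1) * S"
    unfolding S_def sum_distrib_left psi_eq power_diff_1_eq by (intro sum.cong) auto
  finally have g: "g (- 1) = (z - 1) * S" by simp
  have "S \<doteq> (\<Sum>x\<in>U. \<omega> x powi (- 1) * (\<Sum>j<f. \<omega> x ^ (CHAR('a) ^ j)))"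
    unfolding S_def
  proof (rule cg_sum)
    fix x assume x: "x \<in> U"
    have "(\<Sum>i<nat_trace f x. z ^ i) \<doteq> of_nat (nat_trace f x)"
      by (rule cg_geometric_sum[OF z_minus_1_max_ideal])
    also have "\<dots> \<doteq> (\<Sum>j<f. \<omega> x ^ (CHAR('a) ^ j))" using x nat_trace_cg by simp
    finally show "\<omega> x powi (- 1) * (\<Sum>i<nat_trace f x. z ^ i) \<doteq>
        \<omega> x powi (- 1) * (\<Sum>j<f. \<omega> x ^ (CHAR('a) ^ j))"
      using x by (intro cg_mult cg_refl unitD(2)[OF unit_powi[OF unit_omega]]) auto
  qed
  also have "(\<Sum>x\<in>U. \<omega> x powi (- 1) * (\<Sum>j<f. \<omega> x ^ (CHAR('a) ^ j))) =
      (\<Sum>x\<in>U. \<Sum>j<f. \<omega> x powi (int (CHAR('a) ^ j) - 1))"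
  proof (rule sum.cong[OF refl])
    fix x assume "x \<in> U"
    then have "\<omega> x powi (- 1) * \<omega> x ^ n = \<omega> x powi (int n - 1)" for n
      using omega_nz[of x] power_int_add[of "\<omega> x" "- 1" "int n"]
      by (metis mem_Collect_eq uminus_add_conv_diff power_int_of_nat)
    then show "\<omega> x powi (- 1) * (\<Sum>j<f. \<omega> x ^ (CHAR('a) ^ j)) = (\<Sum>j<f. \<omega> x powi (int (CHAR('a) ^ j) - 1))"
      by (simp only: sum_distrib_left)
  qed
  also have "\<dots> = (\<Sum>j<f. \<Sum>x\<in>U. \<omega> x powi (int (CHAR('a) ^ j) - 1))" by (rule sum.swap)
  also have "\<dots> = (\<Sum>j<f. if j = 0 then of_nat ?N else 0)"
  proof (rule sum.cong[OF refl])
    fix j assume j: "j \<in> {..<f}"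
    have "int ?N dvd int (CHAR('a) ^ j) - 1 \<longleftrightarrow> j = 0"
    proof
      assume d: "int ?N dvd int (CHAR('a) ^ j) - 1"
      have "CHAR('a) ^ j < CHAR('a) ^ f" using j CHAR_gt_1 by (intro power_strict_increasing) auto
      then have "int (CHAR('a) ^ j) - 1 < int ?N" using card_gt_1 unfolding card_eq by linarith
      moreover have "CHAR('a) ^ j > 0" using CHAR_gt_1 by simp
      ultimately have "int (CHAR('a) ^ j) - 1 = 0" using zdvd_not_zless[OF _ _, of "int (CHAR('a) ^ j) - 1" "int ?N"] d by linarith
      then have "CHAR('a) ^ j = 1" by linarith
      then show "j = 0" using CHAR_gt_1 by (simp add: power_eq_1_iff)
    qed simp
    then show "(\<Sum>x\<in>U. \<omega> x powi (int (CHAR('a) ^ j) - 1)) = (if j = 0 then of_nat ?N else 0)"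
      by (simp only: sum_omega_powi)
  qed
  also have "\<dots> = of_nat ?N" using f_pos by (simp del: of_nat_diff)
  finally have "unit S" using unit_cg[OF unit_card_minus_1[OF char_max_ideal] cg_sym] by blast
  then show ?thesis using g that by blast
qed

text \<open>This bounds the valuation of \<open>g (- s)\<close> from above by the digit sum of \<open>s\<close>. Adding the bounds for \<open>s\<close> and \<open>- s\<close> and
  comparing with \<open>g (s) g (- s) = \<plusminus> q\<close> shows that both are attained.\<close>

lemma gauss_sum_divides:
  assumes "s < CARD('a) - 1"
  shows "\<exists>n. real n = (real CHAR('a) - 1) * digit_frac_sum CHAR('a) f (int s) \<and>
    g (- int s) \<noteq> 0 \<and> (z - 1) ^ n / g (- int s) \<in> V"
  using assms
proof (induction s rule: less_induct)
  case (less s)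
  let ?p = "CHAR('a)"
  consider "s = 0" | "s > 0" "?p dvd s" | "s > 0" "\<not> ?p dvd s" by blast
  then show ?case
  proof cases
    case 1
    then show ?thesis
      using gauss_sum_trivial[of 0] uminus_mem[OF one_mem]
      by (intro exI[of _ 0]) (auto simp: digit_frac_sum_0)
  next
    case 2
    then obtain s' where s': "s = ?p * s'" by (elim dvdE)
    have "s' < s" using s' 2 CHAR_gt_1 by simp
    then have "\<exists>n. real n = (real ?p - 1) * digit_frac_sum ?p f (int s') \<and>
        g (- int s') \<noteq> 0 \<and> (z - 1) ^ n / g (- int s') \<in> V"
      using less by auto
    moreover have "g (- int s) = g (- int s')" using gauss_sum_frobenius[of "- int s'"] by (simp add: s')
    moreover have "digit_frac_sum ?p f (int s) = digit_frac_sum ?p f (int s')"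
      using digit_frac_sum_mult[OF CHAR_gt_1 f_pos] by (simp add: s')
    ultimately show ?thesis by simp
  next
    case 3
    then obtain s' where s': "s = Suc s'" by (cases s) auto
    have lt: "s' < s" "s' < CARD('a) - 1" using s' less.prems by auto
    obtain n where n: "real n = (real ?p - 1) * digit_frac_sum ?p f (int s')"
      "g (- int s') \<noteq> 0" "(z - 1) ^ n / g (- int s') \<in> V"
      using less.IH[OF lt] by blast
    have "CARD('a) > 2" using s' less.prems by simp
    then obtain e where e: "unit e" "g (- 1) = (z - 1) * e" using gauss_sum_minus_1 by blast
    have e0: "e \<noteq> 0" and z0: "z - 1 \<noteq> 0" using unitD(1)[OF e(1)] z_ne_1 by auto
    have sum: "- int s' + - 1 = - int s" using s' by simp
    have "\<not> int (CARD('a) - 1) dvd - int s"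
      using less.prems 3 by (simp only: dvd_minus_iff int_dvd_int_iff) (auto dest: dvd_imp_le)
    then have J: "g (- int s') * g (- 1) = jacobi_sum (- int s') (- 1) * g (- int s)"
      using gauss_sum_mult[of "- int s'" "- 1"] unfolding sum by blast
    have nz: "g (- int s) \<noteq> 0" using J n(2) e(2) e0 z0 by auto
    \<comment> \<open>Going from \<open>s'\<close> to \<open>s\<close> costs one factor
      \<open>z - 1\<close>, up to a unit and a Jacobi sum in \<open>V\<close>; the digit sum grows
      by one as well.\<close>
    have "(z - 1) ^ Suc n / g (- int s) = (z - 1) ^ n * (g (- int s') * g (- 1)) / (g (- int s) * g (- int s') * e)"
      using nz n(2) e0 unfolding e(2) by simp
    also have "\<dots> = (z - 1) ^ n / g (- int s') * inverse e * jacobi_sum (- int s') (- 1)"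
      using nz unfolding J by (simp add: divide_inverse)
    also have "\<dots> \<in> V" using n(3) unitD(3)[OF e(1)] by (intro mult_mem jacobi_sum_mem)
    finally have "(z - 1) ^ Suc n / g (- int s) \<in> V" .
    moreover have "real (Suc n) = (real ?p - 1) * digit_frac_sum ?p f (int s)"
      using digit_frac_sum_Suc[OF CHAR_gt_1 f_pos, of s'] less.prems 3 n(1) CHAR_gt_1
      unfolding s' card_eq by (simp add: distrib_left)
    ultimately show ?thesis using nz by blast
  qed
qed

theorem gauss_sum_valuation:
  "\<exists>n. real n = (real CHAR('a) - 1) * digit_frac_sum CHAR('a) f s \<and> unit (g (- s) / (z - 1) ^ n)"
proof -
  let ?p = "CHAR('a)" and ?N = "CARD('a) - 1"
  have z0: "z - 1 \<noteq> 0" using z_ne_1 by simp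
  have all: "\<exists>n. real n = (real ?p - 1) * digit_frac_sum ?p f s \<and> g (- s) \<noteq> 0 \<and> (z - 1) ^ n / g (- s) \<in> V" for s
  proof -
    define r where "r = nat (s mod int ?N)"
    have r: "int r = s mod int ?N" "r < ?N" using card_gt_1 by (auto simp: r_def nat_less_iff)
    have d: "int ?N dvd s - int r" unfolding r(1) by (simp only: minus_mod_eq_mult_div dvd_triv_left)
    then have "int ?N dvd - s - - int r" by (metis dvd_minus_iff minus_diff_minus)
    then have "g (- s) = g (- int r)" by (rule gauss_sum_period)
    moreover have "digit_frac_sum ?p f s = digit_frac_sum ?p f (int r)"
      using d unfolding card_eq by (rule digit_frac_sum_period[OF CHAR_gt_1 f_pos])
    ultimately show ?thesis using gauss_sum_divides[OF r(2)] by simp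
  qed
  show ?thesis
  proof (cases "int ?N dvd s")
    case True
    then have "digit_frac_sum ?p f s = 0"
      using digit_frac_sum_period[OF CHAR_gt_1 f_pos, of s 0] digit_frac_sum_0 unfolding card_eq by simp
    moreover have "g (- s) = - 1" using True by (intro gauss_sum_trivial) simp
    ultimately show ?thesis using unit_uminus[OF unit_one] by (intro exI[of _ 0]) simp
  next
    case False
    obtain n where n: "real n = (real ?p - 1) * digit_frac_sum ?p f s" "g (- s) \<noteq> 0" "(z - 1) ^ n / g (- s) \<in> V"
      using all by blast
    obtain n' where n': "real n' = (real ?p - 1) * digit_frac_sum ?p f (- s)" "g s \<noteq> 0" "(z - 1) ^ n' / g s \<in> V"
      using all[of "- s"] by auto
    have "real n + real n' = (real ?p - 1) * (digit_frac_sum ?p f s + digit_frac_sum ?p f (- s))"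
      using n(1) n'(1) by (simp add: distrib_left)
    also have "\<dots> = (real ?p - 1) * real f"
      using digit_frac_sum_uminus[OF CHAR_gt_1 f_pos, of s] False unfolding card_eq by simp
    also have "\<dots> = real ((?p - 1) * f)" using CHAR_gt_1 by (simp add: of_nat_diff)
    finally have nn: "n + n' = (?p - 1) * f" by linarith
    obtain e where e: "unit e" "(z - 1) ^ ((?p - 1) * f) = e * of_nat CARD('a)" by (rule z_minus_1_power)
    have refl: "g s * g (- s) = \<omega> (- 1) powi s * of_nat CARD('a)" using gauss_sum_reflect[OF False] .
    have w: "unit (\<omega> (- 1) powi s)" by (intro unit_powi unit_omega) simp
    have "(z - 1) ^ n / g (- s) * ((z - 1) ^ n' / g s) = (z - 1) ^ (n + n') / (g s * g (- s))"
      by (simp add: power_add mult.commute)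
    also have "\<dots> = e / \<omega> (- 1) powi s" unfolding nn e(2) refl using card_gt_1 by simp
    finally have "unit ((z - 1) ^ n / g (- s) * ((z - 1) ^ n' / g s))" using e(1) w by (simp add: unit_divide)
    then have "unit ((z - 1) ^ n / g (- s))" using n(3) n'(3) by (rule unit_factor)
    then have "unit (g (- s) / (z - 1) ^ n)" using unit_inverse[of "(z - 1) ^ n / g (- s)"] by simp
    then show ?thesis using n(1) by blast
  qed
qed

end

section \<open>Change of the additive character\<close>

context gauss_chars
begin

text \<open>The correlations of \<phi> with the twists of \<psi> add up to \<open>q\<close>, so one
  of them is nonzero, say at \<open>c\<close>. Translating the summation variable by
  \<open>y\<close> multiplies it by \<open>\<phi> y * \<psi> (- y * c)\<close>, which is therefore
  1.\<close>

lemma additive_character_twist: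
  assumes add: "\<And>x y. \<phi> (x + y) = \<phi> x * \<phi> y" and nz: "\<And>x. \<phi> x \<noteq> (0::complex)"
  shows "\<exists>c. \<forall>x. \<phi> x = \<psi> (c * x)"
proof -
  have "(\<Sum>c\<in>UNIV. \<Sum>x\<in>UNIV. \<phi> x * \<psi> (- x * c)) = (\<Sum>x\<in>UNIV. \<Sum>c\<in>UNIV. \<phi> x * \<psi> (- x * c))"
    by (rule sum.swap)
  also have "\<dots> = (\<Sum>x\<in>UNIV. \<phi> x * (if x = 0 then of_nat CARD('a) else 0))"
    by (simp only: sum_distrib_left[symmetric] sum_psi neg_equal_0_iff_equal)
  also have "\<dots> = (\<Sum>x\<in>UNIV. if x = 0 then \<phi> x * of_nat CARD('a) else 0)"
    by (intro sum.cong) auto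
  also have "\<dots> = \<phi> 0 * of_nat CARD('a)" by simp
  finally have "(\<Sum>c\<in>UNIV. \<Sum>x\<in>UNIV. \<phi> x * \<psi> (- x * c)) \<noteq> 0" using nz by simp
  then have "\<not> (\<forall>c\<in>UNIV. (\<Sum>x\<in>UNIV. \<phi> x * \<psi> (- x * c)) = 0)"
    by (rule contrapos_nn) (rule sum.neutral)
  then obtain c where c: "(\<Sum>x\<in>UNIV. \<phi> x * \<psi> (- x * c)) \<noteq> 0" by blast
  have "\<phi> y = \<psi> (c * y)" for y
  proof -
    have "(\<Sum>x\<in>UNIV. \<phi> x * \<psi> (- x * c)) = (\<Sum>x\<in>UNIV. \<phi> (x + y) * \<psi> (- (x + y) * c))"
      by (rule sum.reindex_bij_witness[of _ "\<lambda>x. x + y" "\<lambda>x. x - y"]) auto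
    also have "\<dots> = (\<phi> y * \<psi> (- y * c)) * (\<Sum>x\<in>UNIV. \<phi> x * \<psi> (- x * c))"
      unfolding sum_distrib_left
    proof (rule sum.cong[OF refl])
      fix x
      have "- (x + y) * c = - x * c + - y * c" by (simp add: algebra_simps)
      then have "\<psi> (- (x + y) * c) = \<psi> (- x * c) * \<psi> (- y * c)" by (simp only: psi_add)
      then show "\<phi> (x + y) * \<psi> (- (x + y) * c) = \<phi> y * \<psi> (- y * c) * (\<phi> x * \<psi> (- x * c))"
        by (simp only: add mult_ac)
    qed
    finally have "\<phi> y * \<psi> (- y * c) = 1" using c by simp
    moreover have "\<psi> (c * y) * \<psi> (- y * c) = 1"
      using psi_add[of "c * y" "- y * c"] psi_0 by (simp add: mult.commute)
    ultimately show ?thesis using psi_nz by (metis mult_right_cancel)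
  qed
  then show ?thesis by blast
qed

lemma gauss_sum_twist:
  assumes c: "c \<noteq> 0"
  shows "gauss_sum \<omega> (\<lambda>x. \<psi> (c * x)) a = \<omega> c powi (- a) * g a"
proof -
  have "g a = (\<Sum>x\<in>U. \<omega> (c * x) powi a * \<psi> (c * x))"
    unfolding gauss_sum_def
    by (rule sum.reindex_bij_witness[of _ "\<lambda>x. c * x" "\<lambda>x. x / c"]) (use c in auto)
  also have "\<dots> = \<omega> c powi a * gauss_sum \<omega> (\<lambda>x. \<psi> (c * x)) a"
    unfolding gauss_sum_def sum_distrib_left using c by (intro sum.cong) (auto simp: omega_powi_mult)
  finally show ?thesis using omega_nz[OF c] by (simp add: power_int_minus)
qed

end

context gauss_chars_valuation
begin

text \<open>\<psi> is a twist by some \<open>c \<noteq> 0\<close> of a standard character, which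
  changes Gauss sums by roots of unity only. Exponents are rescaled by an inverse \<open>m'\<close>
  of \<open>m\<close> modulo \<open>q - 1\<close> to pass from \<omega> to its \<open>m\<close>-th
  power \<theta>. Then \<open>w = z - 1\<close> and \<open>k = - m'\<close>, with the sign because
  \<open>gauss_sum_valuation\<close> speaks of \<open>g (- s)\<close>.\<close>

theorem gauss_sum_valuation_at_p:
  assumes p: "of_nat CHAR('a) \<in> max_ideal"
  obtains f w k n e where "CARD('a) = CHAR('a) ^ f" "coprime k (int (CARD('a) - 1))"
    "w \<noteq> 0" "w \<in> V" "unit e" "w ^ ((CHAR('a) - 1) * f) = e * of_nat CARD('a)"
    "\<forall>a::int. real (n a) = (real CHAR('a) - 1) * digit_frac_sum CHAR('a) f (k * a)"
    "\<forall>a. unit (g a / w ^ n a)"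
proof -
  let ?N = "CARD('a) - 1"
  obtain m where m: "coprime m ?N" "teichmueller \<psi> (\<lambda>x. if x = 0 then 0 else \<omega> x ^ m) V"
    using exists_teichmueller[OF p] by blast
  define \<theta> where "\<theta> x = (if x = 0 then 0 else \<omega> x ^ m)" for x
  interpret \<theta>: teichmueller \<psi> \<theta> V using m(2) unfolding \<theta>_def .
  obtain f where f: "CARD('a) = CHAR('a) ^ f" using card_finite_field_eq_CHAR_power by blast
  then have f0: "f > 0" using card_gt_1 by (cases f) auto
  obtain x1 where x1: "\<psi> x1 \<noteq> 1" using psi_nontriv by blast
  \<comment> \<open>Any value of \<psi> other than 1 is a primitive \<open>p\<close>-th root of
    unity.\<close>
  define z where "z = \<psi> x1"
  have z: "z ^ CHAR('a) = 1" "z \<noteq> 1" using psi_root x1 by (auto simp: z_def)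
  define \<phi> where "\<phi> x = z ^ nat_trace f x" for x :: 'a
  interpret \<phi>: gauss_chars \<phi> \<theta>
  proof
    show "\<phi> (x + y) = \<phi> x * \<phi> y" for x y
      unfolding \<phi>_def by (rule standard_additive_character[OF f z(1)])
    have "z \<noteq> 0" using z CHAR_pos_iff prime_gt_0_nat[OF prime_CHAR_finite_field[where 'a='a]] by (auto simp: power_0_left)
    then show "\<phi> x \<noteq> 0" for x by (simp add: \<phi>_def)
    show "\<exists>x. \<phi> x \<noteq> 1" unfolding \<phi>_def by (rule standard_additive_character_nontrivial[OF f f0 z])
  qed (use \<theta>.omega_mult \<theta>.omega_nz \<theta>.omega_order in auto)
  interpret \<phi>: gauss_chars_valuation \<phi> \<theta> V ..
  interpret \<phi>: stickelberger \<phi> \<theta> V f z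
    by unfold_locales (use p \<theta>.omega_0 \<theta>.omega_add f z \<phi>_def in auto)
  obtain c where c: "\<And>x. \<psi> x = \<phi> (c * x)"
    using \<phi>.additive_character_twist[of \<psi>, OF psi_add psi_nz] by blast
  have c0: "c \<noteq> 0" using x1 c[of x1] \<phi>.psi_0 by auto
  obtain m' where m': "[int m * m' = 1] (mod int ?N)"
    using m(1) cong_solve_coprime_int[of "int m" "int ?N"] by (metis coprime_int_iff)
  have cop: "coprime (- m') (int ?N)"
    using m' by (metis coprime_iff_invertible_int coprime_minus_left_iff mult.commute)
  have g: "g a = \<theta> c powi (- (m' * a)) * \<phi>.g (m' * a)" for a
  proof -
    have "g a = gauss_sum \<theta> \<psi> (m' * a)"
      unfolding gauss_sum_def
    proof (rule sum.cong[OF refl])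
      fix x assume x: "x \<in> U"
      have "int ?N dvd int m * m' - 1" using m' by (simp only: cong_iff_dvd_diff)
      then have "int ?N dvd (int m * m' - 1) * a" by (rule dvd_mult2)
      then have "int ?N dvd int m * (m' * a) - a" by (simp only: left_diff_distrib mult_1 mult.assoc)
      then have "\<omega> x powi (int m * (m' * a)) = \<omega> x powi a" using x by (intro omega_powi_period) auto
      then show "\<omega> x powi a * \<psi> x = \<theta> x powi (m' * a) * \<psi> x"
        using x by (simp add: \<theta>_def power_int_mult)
    qed
    also have "\<dots> = gauss_sum \<theta> (\<lambda>x. \<phi> (c * x)) (m' * a)" unfolding gauss_sum_def by (simp only: c)
    also have "\<dots> = \<theta> c powi (- (m' * a)) * \<phi>.g (m' * a)" by (rule \<phi>.gauss_sum_twist[OF c0])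
    finally show ?thesis .
  qed
  have "\<exists>n. real n = (real CHAR('a) - 1) * digit_frac_sum CHAR('a) f (- m' * a) \<and> unit (g a / (z - 1) ^ n)" for a
  proof -
    obtain n where n: "real n = (real CHAR('a) - 1) * digit_frac_sum CHAR('a) f (- m' * a)"
      "unit (\<phi>.g (m' * a) / (z - 1) ^ n)"
      using \<phi>.gauss_sum_valuation[of "- m' * a"] by auto
    have "unit (\<theta> c powi (- (m' * a)) * (\<phi>.g (m' * a) / (z - 1) ^ n))"
      by (intro unit_mult unit_powi n(2) \<theta>.unit_omega c0)
    then show ?thesis using n(1) g by auto
  qed
  then obtain n where "\<forall>a. real (n a) = (real CHAR('a) - 1) * digit_frac_sum CHAR('a) f (- m' * a)"
    "\<forall>a. unit (g a / (z - 1) ^ n a)"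
    by metis
  moreover obtain e where "unit e" "(z - 1) ^ ((CHAR('a) - 1) * f) = e * of_nat CARD('a)"
    by (rule \<phi>.z_minus_1_power)
  moreover have "z - 1 \<noteq> 0" "z - 1 \<in> V"
    using z \<phi>.z_minus_1_max_ideal max_ideal_subset by auto
  ultimately show ?thesis using that f cop by blast
qed

section \<open>Valuation rings in which \<open>p\<close> is a unit\<close>

lemma unit_gauss_sum:
  assumes "unit (of_nat CHAR('a))" shows "unit (g a)"
proof (cases "int (CARD('a) - 1) dvd a")
  case True
  then show ?thesis using gauss_sum_trivial[OF True] unit_uminus[OF unit_one] by simp
next
  case False
  obtain f where "CARD('a) = CHAR('a) ^ f" using card_finite_field_eq_CHAR_power by blast
  then have "unit (of_nat CARD('a))" using unit_power[OF assms, of f] by simp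
  then have "unit (g a * g (- a))"
    unfolding gauss_sum_reflect[OF False] by (intro unit_mult unit_powi unit_omega) auto
  then show ?thesis using gauss_sum_mem gauss_sum_mem by (rule unit_factor)
qed

text \<open>The image of the group ring of the nonzero field elements over \<open>V\<close>, as
  functions of \<open>m\<close>. The class contains the numerators of the hypergeometric sum, and
  summing a member over a full period produces the factor \<open>q - 1\<close>.\<close>

definition omega_comb :: "(int \<Rightarrow> complex) \<Rightarrow> bool" where
  "omega_comb F \<longleftrightarrow> (\<exists>v. (\<forall>c. v c \<in> V) \<and> (\<forall>m. F m = (\<Sum>c\<in>U. v c * \<omega> c powi m)))"

lemma omega_combI: "(\<And>c. v c \<in> V) \<Longrightarrow> (\<And>m. F m = (\<Sum>c\<in>U. v c * \<omega> c powi m)) \<Longrightarrow> omega_comb F"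
  unfolding omega_comb_def by (intro exI[of _ v] conjI allI)

lemma omega_comb_single:
  assumes "c \<noteq> 0" shows "omega_comb (\<lambda>m. \<omega> c powi m)"
proof (rule omega_combI[of "\<lambda>x. if x = c then 1 else 0"])
  fix m
  have "(\<Sum>x\<in>U. (if x = c then 1 else 0) * \<omega> x powi m) = (\<Sum>x\<in>U. if x = c then \<omega> x powi m else 0)"
    by (intro sum.cong) auto
  then show "\<omega> c powi m = (\<Sum>x\<in>U. (if x = c then 1 else 0) * \<omega> x powi m)" using assms by simp
qed (simp add: one_mem zero_mem)

text \<open>Coefficients convolve over the multiplicative group, as in a group ring.\<close>

lemma omega_comb_mult:
  assumes "omega_comb F" "omega_comb G" shows "omega_comb (\<lambda>m. F m * G m)"
proof -
  obtain v where v: "\<And>c. v c \<in> V" "\<And>m. F m = (\<Sum>c\<in>U. v c * \<omega> c powi m)"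
    using assms(1) unfolding omega_comb_def by blast
  obtain w where w: "\<And>c. w c \<in> V" "\<And>m. G m = (\<Sum>c\<in>U. w c * \<omega> c powi m)"
    using assms(2) unfolding omega_comb_def by blast
  show ?thesis
  proof (rule omega_combI[of "\<lambda>c. \<Sum>b\<in>U. v b * w (c / b)"])
    show "(\<Sum>b\<in>U. v b * w (c / b)) \<in> V" for c using v w by (intro sum_mem mult_mem)
    fix m
    have "F m * G m = (\<Sum>b\<in>U. \<Sum>d\<in>U. (v b * \<omega> b powi m) * (w d * \<omega> d powi m))"
      by (simp add: v w sum_product)
    also have "\<dots> = (\<Sum>b\<in>U. \<Sum>c\<in>U. v b * w (c / b) * \<omega> c powi m)"
    proof (rule sum.cong[OF refl])
      fix b assume b: "b \<in> U"
      show "(\<Sum>d\<in>U. (v b * \<omega> b powi m) * (w d * \<omega> d powi m)) = (\<Sum>c\<in>U. v b * w (c / b) * \<omega> c powi m)"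
        by (rule sum.reindex_bij_witness[of _ "\<lambda>c. c / b" "\<lambda>d. b * d"])
          (use b in \<open>auto simp: omega_powi_mult\<close>)
    qed
    also have "\<dots> = (\<Sum>c\<in>U. \<Sum>b\<in>U. v b * w (c / b) * \<omega> c powi m)" by (rule sum.swap)
    finally show "F m * G m = (\<Sum>c\<in>U. (\<Sum>b\<in>U. v b * w (c / b)) * \<omega> c powi m)"
      by (simp only: sum_distrib_right)
  qed
qed

lemma omega_comb_prod:
  "finite I \<Longrightarrow> (\<And>i. i \<in> I \<Longrightarrow> omega_comb (F i)) \<Longrightarrow> omega_comb (\<lambda>m. \<Prod>i\<in>I. F i m)"
proof (induction I rule: finite_induct)
  case empty
  then show ?case using omega_comb_single[of 1] by (simp add: omega_1)
next
  case (insert i I)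
  then show ?case using omega_comb_mult[of "F i" "\<lambda>m. \<Prod>i\<in>I. F i m"] by simp
qed

lemma omega_comb_gauss_sum: "omega_comb (\<lambda>m. g (m + a))" "omega_comb (\<lambda>m. g (- m - a))"
proof -
  show "omega_comb (\<lambda>m. g (m + a))"
  proof (rule omega_combI[of "\<lambda>x. if x = 0 then 0 else \<omega> x powi a * \<psi> x"])
    show "(if x = 0 then 0 else \<omega> x powi a * \<psi> x) \<in> V" for x
      by (auto intro!: zero_mem mult_mem unitD(2)[OF unit_psi] unitD(2)[OF unit_powi] unit_omega)
    show "g (m + a) = (\<Sum>x\<in>U. (if x = 0 then 0 else \<omega> x powi a * \<psi> x) * \<omega> x powi m)" for m
      unfolding gauss_sum_def by (intro sum.cong) (auto simp: power_int_add omega_nz)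
  qed
  show "omega_comb (\<lambda>m. g (- m - a))"
  proof (rule omega_combI[of "\<lambda>x. if x = 0 then 0 else \<omega> x powi a * \<psi> (inverse x)"])
    show "(if x = 0 then 0 else \<omega> x powi a * \<psi> (inverse x)) \<in> V" for x
      by (auto intro!: zero_mem mult_mem unitD(2)[OF unit_psi] unitD(2)[OF unit_powi] unit_omega)
    fix m
    have inv: "\<omega> (inverse x) powi (- m - a) = \<omega> x powi a * \<omega> x powi m" if x: "x \<noteq> 0" for x
    proof -
      have "\<omega> (inverse x) * \<omega> x = 1" using omega_mult[of "inverse x" x] x omega_1 by simp
      then have "\<omega> (inverse x) = inverse (\<omega> x)" by (metis inverse_unique inverse_inverse_eq)
      moreover have "- m - a = - (a + m)" by simp
      ultimately have "\<omega> (inverse x) powi (- m - a) = \<omega> x powi (a + m)"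
        by (simp only: power_int_minus power_int_inverse inverse_inverse_eq)
      then show ?thesis using omega_nz[OF x] power_int_add[of "\<omega> x" a m] by simp
    qed
    have "g (- m - a) = (\<Sum>x\<in>U. \<omega> (inverse x) powi (- m - a) * \<psi> (inverse x))"
      unfolding gauss_sum_def by (rule sum.reindex_bij_witness[of _ inverse inverse]) auto
    then show "g (- m - a) = (\<Sum>x\<in>U. (if x = 0 then 0 else \<omega> x powi a * \<psi> (inverse x)) * \<omega> x powi m)"
      by (simp add: inv mult_ac)
  qed
qed

text \<open>Since \<omega> is injective, summation over \<open>m\<close> kills every
  \<open>c \<noteq> 1\<close>, and \<open>c = 1\<close> contributes \<open>q - 1\<close> times its
  coefficient.\<close>

lemma omega_comb_sum:
  assumes "omega_comb F"
  obtains v where "v \<in> V" "(\<Sum>m<CARD('a) - 1. F (int m)) = of_nat (CARD('a) - 1) * v"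
proof -
  let ?N = "CARD('a) - 1"
  obtain v where v: "\<And>c. v c \<in> V" "\<And>m. F m = (\<Sum>c\<in>U. v c * \<omega> c powi m)"
    using assms unfolding omega_comb_def by blast
  have geo: "(\<Sum>m<?N. \<omega> c ^ m) = (if c = 1 then of_nat ?N else 0)" if c: "c \<noteq> 0" for c
  proof (cases "c = 1")
    case False
    then have "\<omega> c \<noteq> 1" using inj_onD[OF omega_inj, of c 1] c omega_1 by auto
    moreover have "(\<omega> c - 1) * (\<Sum>m<?N. \<omega> c ^ m) = 0"
      using power_diff_1_eq[of "\<omega> c" ?N] omega_root[OF c] by simp
    ultimately show ?thesis using False by simp
  qed (simp add: omega_1)
  have "(\<Sum>m<?N. F (int m)) = (\<Sum>c\<in>U. v c * (\<Sum>m<?N. \<omega> c ^ m))"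
    unfolding v(2) sum_distrib_left by (subst sum.swap) simp
  also have "\<dots> = (\<Sum>c\<in>U. if c = 1 then v c * of_nat ?N else 0)"
  proof (rule sum.cong[OF refl])
    fix c assume "c \<in> U"
    then show "v c * (\<Sum>m<?N. \<omega> c ^ m) = (if c = 1 then v c * of_nat ?N else 0)"
      using geo[of c] by (cases "c = 1") simp_all
  qed
  also have "\<dots> = of_nat ?N * v 1" by (simp add: mult.commute del: of_nat_diff)
  finally show ?thesis using that v(1) by blast
qed

end

section \<open>Integrality, bounds and periodicity of \<Lambda>; the exponent \<lambda>\<close>

lemma Lambda_fn_Ints: "Lambda_fn alpha beta x \<in> \<int>"
proof -
  have "frac (x + a) - frac a + frac (- x - b) - frac (- b) =
      of_int (\<lfloor>a\<rfloor> - \<lfloor>x + a\<rfloor> + \<lfloor>- b\<rfloor> - \<lfloor>- x - b\<rfloor>)" for a b :: real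
    by (simp add: frac_def)
  then show ?thesis unfolding Lambda_fn_def by (simp only: Ints_of_int Ints_sum)
qed

lemma Lambda_fn_ge: "Lambda_fn alpha beta x \<ge> - 2 * real (length alpha)"
proof -
  have "frac (x + a) - frac a + frac (- x - b) - frac (- b) \<ge> - 2" for a b :: real
    using frac_ge_0[of "x + a"] frac_lt_1[of a] frac_ge_0[of "- x - b"] frac_lt_1[of "- b"] by linarith
  then have "Lambda_fn alpha beta x \<ge> (\<Sum>i<length alpha. - 2)"
    unfolding Lambda_fn_def by (intro sum_mono)
  then show ?thesis by simp
qed

lemma Lambda_fn_frac: "Lambda_fn alpha beta (frac x) = Lambda_fn alpha beta x"
proof -
  have "frac (frac x + a) = frac (x + a)" "frac (- frac x - a) = frac (- x - a)" for a
    using frac_add_of_int[of "x + a" "- \<lfloor>x\<rfloor>"] frac_add_of_int[of "- x - a" "\<lfloor>x\<rfloor>"]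
    by (simp_all add: frac_def[of x] algebra_simps)
  then show ?thesis by (simp only: Lambda_fn_def)
qed

text \<open>The values of \<Lambda> are integers bounded below, so the infimum is attained and is an
  integer. It is at most 0 because \<open>k = 1\<close>, \<open>x = 0\<close> gives the value 0.
  Periodicity extends the bound from the unit interval to all real \<open>x\<close>.\<close>

lemma lambda_exp_properties:
  obtains l :: nat where "lambda_exp alpha beta N = real l"
    "\<And>k x. coprime k (int N) \<Longrightarrow>
      Lambda_fn (map (\<lambda>a. of_int k * a) alpha) (map (\<lambda>a. of_int k * a) beta) x \<ge> - real l"
proof -
  define S where "S = {Lambda_fn (map (\<lambda>a. of_int k * a) alpha) (map (\<lambda>a. of_int k * a) beta) x
           | k x. coprime k (int N) \<and> x \<in> {0..1}}"
  have lam: "lambda_exp alpha beta N = - Inf S" by (simp add: lambda_exp_def S_def)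
  have "Lambda_fn (map (\<lambda>a. of_int 1 * a) alpha) (map (\<lambda>a. of_int 1 * a) beta) 0 \<in> S"
    unfolding S_def by (rule CollectI, rule exI[of _ 1], rule exI[of _ 0], intro conjI refl) auto
  then have 0: "0 \<in> S" by (simp add: Lambda_fn_def)
  have bdd: "bdd_below S"
  proof (rule bdd_belowI)
    fix y assume "y \<in> S"
    then obtain k x where "y = Lambda_fn (map (\<lambda>a. of_int k * a) alpha) (map (\<lambda>a. of_int k * a) beta) x"
      by (auto simp: S_def)
    then show "- 2 * real (length alpha) \<le> y"
      using Lambda_fn_ge[of "map (\<lambda>a. of_int k * a) alpha" "map (\<lambda>a. of_int k * a) beta" x] by simp
  qed
  have "S \<subseteq> \<int>" using Lambda_fn_Ints by (auto simp: S_def)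
  then have "closed S" by (rule closed_subset_Ints)
  then have "Inf S \<in> S" using 0 bdd by (intro closed_contains_Inf) auto
  then have "Inf S \<in> \<int>" using \<open>S \<subseteq> \<int>\<close> by blast
  moreover have "Inf S \<le> 0" using 0 bdd by (rule cInf_lower)
  ultimately obtain i where i: "Inf S = of_int i" "i \<le> 0" by (elim Ints_cases) auto
  have l: "lambda_exp alpha beta N = real (nat (- i))" using lam i by simp
  show ?thesis
  proof (rule that[OF l])
    fix k and x :: real assume k: "coprime k (int N)"
    have "frac x \<in> {0..1}" by (simp add: less_imp_le[OF frac_lt_1])
    then have "Lambda_fn (map (\<lambda>a. of_int k * a) alpha) (map (\<lambda>a. of_int k * a) beta) (frac x) \<in> S"
      unfolding S_def using k by blast
    then have "Inf S \<le> Lambda_fn (map (\<lambda>a. of_int k * a) alpha) (map (\<lambda>a. of_int k * a) beta) (frac x)"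
      using bdd by (rule cInf_lower)
    then show "Lambda_fn (map (\<lambda>a. of_int k * a) alpha) (map (\<lambda>a. of_int k * a) beta) x \<ge> - real (nat (- i))"
      using i by (simp add: Lambda_fn_frac)
  qed
qed

text \<open>Used with \<open>n = q - 1\<close>: a multiplier prime to \<open>q - 1\<close> is then
  prime to the common denominator, as \<open>lambda_exp\<close> demands.\<close>

lemma common_denom_dvd:
  assumes "\<And>a. a \<in> set xs \<Longrightarrow> of_nat n * a \<in> \<int>" shows "common_denom xs dvd n"
  unfolding common_denom_def
proof (rule Lcm_least)
  fix d assume "d \<in> set (map (\<lambda>a. nat (snd (quotient_of a))) xs)"
  then obtain a where a: "a \<in> set xs" "d = nat (snd (quotient_of a))" by auto
  obtain r s where rs: "quotient_of a = (r, s)" by (cases "quotient_of a")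
  have s: "s > 0" "coprime r s" "a = of_int r / of_int s"
    using quotient_of_denom_pos[OF rs] quotient_of_coprime[OF rs] quotient_of_div[OF rs] by auto
  obtain i where "of_nat n * a = of_int i" using assms[OF a(1)] by (elim Ints_cases)
  then have "of_nat n * of_int r = (of_int i * of_int s :: rat)" using s by (simp add: field_simps)
  then have "of_int (int n * r) = (of_int (i * s) :: rat)" by simp
  then have "int n * r = i * s" by (simp only: of_int_eq_iff)
  then have "s dvd int n * r" by simp
  then have "s dvd int n" using s(2) by (simp add: coprime_dvd_mult_left_iff coprime_commute)
  then show "d dvd n" using a(2) rs s(1) by (metis int_dvd_int_iff int_nat_eq less_imp_le snd_conv)
qed

section \<open>The hypergeometric sum\<close>

lemma of_int_qbar_mult:
  assumes "of_nat (n - 1) * a \<in> \<int>" shows "real_of_int (qbar_mult n a) = real (n - 1) * real_of_rat a"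
proof -
  obtain i where i: "of_nat (n - 1) * a = of_int i" using assms by (elim Ints_cases)
  then have "qbar_mult n a = i" by (simp add: qbar_mult_def mult.commute)
  then have "real_of_int (qbar_mult n a) = real_of_rat (of_nat (n - 1) * a)" using i by simp
  then show ?thesis by (simp only: of_rat_mult of_rat_of_nat_eq)
qed

text \<open>The \<open>j\<close>-th summands of the four digit sums are the four fractional parts in
  \<Lambda>, with parameters scaled by \<open>p ^ j * k\<close> and
  \<open>x = p ^ j * k * m / (p ^ f - 1)\<close>. Exchanging the sums over digits and parameters
  collects them.\<close>

lemma digit_frac_sum_eq_Lambda_fn:
  fixes alpha beta :: "rat list" and a b :: "nat \<Rightarrow> int"
  assumes N: "real p ^ f - 1 \<noteq> 0" and len: "length beta = length alpha"
    and a: "\<And>i. i < length alpha \<Longrightarrow> of_int (a i) = (real p ^ f - 1) * real_of_rat (alpha ! i)"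
    and b: "\<And>i. i < length alpha \<Longrightarrow> of_int (b i) = (real p ^ f - 1) * real_of_rat (beta ! i)"
  shows "(\<Sum>i<length alpha. digit_frac_sum p f (k * (m + a i)) + digit_frac_sum p f (k * (- m - b i))
      - digit_frac_sum p f (k * a i) - digit_frac_sum p f (k * (- b i))) =
    (\<Sum>j<f. Lambda_fn (map (\<lambda>x. of_int (int p ^ j * k) * x) alpha) (map (\<lambda>x. of_int (int p ^ j * k) * x) beta)
      (real p ^ j * of_int k * of_int m / (real p ^ f - 1)))"
proof -
  define c where "c j = real p ^ j * of_int k" for j
  let ?x = "\<lambda>j. c j * of_int m / (real p ^ f - 1)"
  let ?t = "\<lambda>i j. frac (?x j + c j * real_of_rat (alpha ! i)) - frac (c j * real_of_rat (alpha ! i))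
      + frac (- ?x j - c j * real_of_rat (beta ! i)) - frac (- (c j * real_of_rat (beta ! i)))"
  have "(\<Sum>i<length alpha. digit_frac_sum p f (k * (m + a i)) + digit_frac_sum p f (k * (- m - b i))
      - digit_frac_sum p f (k * a i) - digit_frac_sum p f (k * (- b i))) = (\<Sum>i<length alpha. \<Sum>j<f. ?t i j)"
  proof (rule sum.cong[OF refl])
    fix i assume "i \<in> {..<length alpha}"
    then have ab: "of_int (a i) / (real p ^ f - 1) = real_of_rat (alpha ! i)"
      "of_int (b i) / (real p ^ f - 1) = real_of_rat (beta ! i)"
      using a[of i] b[of i] N by simp_all
    have "digit_frac_sum p f (k * (m + a i)) = (\<Sum>j<f. frac (?x j + c j * real_of_rat (alpha ! i)))"
      "digit_frac_sum p f (k * a i) = (\<Sum>j<f. frac (c j * real_of_rat (alpha ! i)))"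
      "digit_frac_sum p f (k * (- m - b i)) = (\<Sum>j<f. frac (- ?x j - c j * real_of_rat (beta ! i)))"
      "digit_frac_sum p f (k * (- b i)) = (\<Sum>j<f. frac (- (c j * real_of_rat (beta ! i))))"
      unfolding digit_frac_sum_def
      by (intro sum.cong refl arg_cong[of _ _ frac]; simp add: c_def ab[symmetric] algebra_simps diff_divide_distrib add_divide_distrib)+
    then show "digit_frac_sum p f (k * (m + a i)) + digit_frac_sum p f (k * (- m - b i))
      - digit_frac_sum p f (k * a i) - digit_frac_sum p f (k * (- b i)) = (\<Sum>j<f. ?t i j)"
      by (simp only: sum.distrib sum_subtractf)
  qed
  also have "\<dots> = (\<Sum>j<f. \<Sum>i<length alpha. ?t i j)" by (rule sum.swap)
  also have "\<dots> = (\<Sum>j<f. Lambda_fn (map (\<lambda>x. of_int (int p ^ j * k) * x) alpha)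
      (map (\<lambda>x. of_int (int p ^ j * k) * x) beta) (?x j))"
    unfolding Lambda_fn_def
    by (intro sum.cong) (auto simp: len c_def of_rat_mult of_rat_power)
  finally show ?thesis by (simp only: c_def)
qed

context gauss_chars_valuation
begin

abbreviation hypergeom_term :: "rat list \<Rightarrow> rat list \<Rightarrow> int \<Rightarrow> complex" where
  "hypergeom_term alpha beta m \<equiv>
    (\<Prod>i<length alpha. g (m + qbar_mult CARD('a) (alpha ! i)) * g (- m - qbar_mult CARD('a) (beta ! i))
      / (g (qbar_mult CARD('a) (alpha ! i)) * g (- qbar_mult CARD('a) (beta ! i))))"

text \<open>The denominators have the unit product \<open>C\<close>, independent of
  \<open>m\<close>, and the numerators form an \<open>omega_comb\<close>; its sum over
  \<open>m\<close> supplies the factor that cancels \<open>1 - q\<close>, which may itself be a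
  nonunit here.\<close>

lemma hypergeom_Hq_mem_of_unit:
  assumes p: "unit (of_nat CHAR('a))" and t: "t \<noteq> 0"
  shows "hypergeom_Hq \<omega> \<psi> alpha beta t \<in> V"
proof -
  let ?A = "\<lambda>i. qbar_mult CARD('a) (alpha ! i)" and ?B = "\<lambda>i. qbar_mult CARD('a) (beta ! i)"
    and ?d = "length alpha" and ?N = "CARD('a) - 1"
  define s where "s = (-1) ^ ?d * t"
  have s: "s \<noteq> 0" using t by (simp add: s_def)
  define C where "C = (\<Prod>i<?d. g (?A i) * g (- ?B i))"
  have C: "unit C" unfolding C_def by (intro unit_prod unit_mult unit_gauss_sum p)
  define F where "F m = (\<Prod>i<?d. g (m + ?A i) * g (- m - ?B i)) * \<omega> s powi m" for m
  have "omega_comb F"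
    unfolding F_def
    by (intro omega_comb_mult omega_comb_prod omega_comb_gauss_sum omega_comb_single s) simp
  then obtain v where v: "v \<in> V" "(\<Sum>m<?N. F (int m)) = of_nat ?N * v" by (rule omega_comb_sum)
  have N: "(of_nat ?N :: complex) = - (1 - of_nat CARD('a))" "1 - of_nat CARD('a) \<noteq> (0::complex)"
    using card_gt_1 by (simp_all add: of_nat_diff)
  have "hypergeom_Hq \<omega> \<psi> alpha beta t = 1 / (1 - of_nat CARD('a)) * (\<Sum>m<?N. F (int m) / C)"
    unfolding hypergeom_Hq_def Let_def F_def C_def s_def by (simp only: prod_dividef power_int_of_nat times_divide_eq_left)
  also have "\<dots> = 1 / (1 - of_nat CARD('a)) * (- (1 - of_nat CARD('a)) * v / C)"
    by (simp only: sum_divide_distrib[symmetric] v(2) N(1))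
  also have "\<dots> = - v / C"
  proof -
    have "1 / D * (- D * v / C) = - v / C" if "D \<noteq> 0" for D using that by simp
    then show ?thesis using N(2) .
  qed
  also have "\<dots> = - v * inverse C" by (simp add: divide_inverse)
  also have "\<dots> \<in> V" using v C by (intro mult_mem uminus_mem unitD(3))
  finally show ?thesis .
qed

lemma hypergeom_term_mem:
  assumes p: "of_nat CHAR('a) \<in> max_ideal"
    and len: "length beta = length alpha"
    and integral: "\<And>a. a \<in> set (alpha @ beta) \<Longrightarrow> of_nat (CARD('a) - 1) * a \<in> \<int>"
    and Lam: "\<And>k x. coprime k (int (common_denom (alpha @ beta))) \<Longrightarrow>
      Lambda_fn (map (\<lambda>a. of_int k * a) alpha) (map (\<lambda>a. of_int k * a) beta) x \<ge> - real l"
  shows "of_nat CARD('a) ^ l * hypergeom_term alpha beta m \<in> V"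
proof -
  let ?A = "\<lambda>i. qbar_mult CARD('a) (alpha ! i)" and ?B = "\<lambda>i. qbar_mult CARD('a) (beta ! i)"
    and ?d = "length alpha" and ?p = "CHAR('a)"
  obtain f w k n e where f: "CARD('a) = ?p ^ f" and k: "coprime k (int (CARD('a) - 1))"
    and w: "w \<noteq> 0" "w \<in> V" and e: "unit e" "w ^ ((?p - 1) * f) = e * of_nat CARD('a)"
    and n': "\<forall>a::int. real (n a) = (real ?p - 1) * digit_frac_sum ?p f (k * a)"
    and gn: "\<forall>a. unit (g a / w ^ n a)"
    by (rule gauss_sum_valuation_at_p[OF p])
  have n: "real (n a) = (real ?p - 1) * digit_frac_sum ?p f (k * a)" for a using n' by simp
  have f0: "f > 0" using f card_gt_1 by (cases f) auto
  have p1: "?p > 1" using prime_CHAR_finite_field[where 'a='a] prime_gt_1_nat by blast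
  have N: "real ?p ^ f - 1 = real (CARD('a) - 1)" using f card_gt_1 by (simp add: of_nat_diff)
  \<comment> \<open>\<open>P\<close> and \<open>Q\<close> are the exponents of \<open>w\<close> in
    the numerator, to which \<open>q ^ l\<close> contributes \<open>(p - 1) * f * l\<close>, and in
    the denominator. All other factors are units, so only \<open>Q \<le> P\<close> has to be
    shown.\<close>
  define P where "P = (?p - 1) * f * l + (\<Sum>i<?d. n (m + ?A i) + n (- m - ?B i))"
  define Q where "Q = (\<Sum>i<?d. n (?A i) + n (- ?B i))"
  have "real P - real Q = (real ?p - 1) * (real f * real l +
      (\<Sum>i<?d. digit_frac_sum ?p f (k * (m + ?A i)) + digit_frac_sum ?p f (k * (- m - ?B i))
      - digit_frac_sum ?p f (k * ?A i) - digit_frac_sum ?p f (k * (- ?B i))))"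
  proof -
    have "real P - real Q = (real ?p - 1) * real f * real l +
      (\<Sum>i<?d. real (n (m + ?A i)) + real (n (- m - ?B i)) - real (n (?A i)) - real (n (- ?B i)))"
      using p1 by (simp add: P_def Q_def of_nat_diff sum_subtractf sum.distrib)
    also have "(\<Sum>i<?d. real (n (m + ?A i)) + real (n (- m - ?B i)) - real (n (?A i)) - real (n (- ?B i))) =
      (real ?p - 1) * (\<Sum>i<?d. digit_frac_sum ?p f (k * (m + ?A i)) + digit_frac_sum ?p f (k * (- m - ?B i))
      - digit_frac_sum ?p f (k * ?A i) - digit_frac_sum ?p f (k * (- ?B i)))"
      unfolding n sum_distrib_left by (intro sum.cong refl) (simp only: distrib_left right_diff_distrib)
    finally show ?thesis by (simp only: distrib_left mult.assoc)
  qed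
  also have "(\<Sum>i<?d. digit_frac_sum ?p f (k * (m + ?A i)) + digit_frac_sum ?p f (k * (- m - ?B i))
      - digit_frac_sum ?p f (k * ?A i) - digit_frac_sum ?p f (k * (- ?B i))) =
    (\<Sum>j<f. Lambda_fn (map (\<lambda>x. of_int (int ?p ^ j * k) * x) alpha) (map (\<lambda>x. of_int (int ?p ^ j * k) * x) beta)
      (real ?p ^ j * of_int k * of_int m / (real ?p ^ f - 1)))"
  proof (rule digit_frac_sum_eq_Lambda_fn[OF _ len])
    show "real ?p ^ f - 1 \<noteq> 0" unfolding N using card_gt_1 by simp
    fix i assume i: "i < ?d"
    show "of_int (?A i) = (real ?p ^ f - 1) * real_of_rat (alpha ! i)"
      unfolding N using i by (intro of_int_qbar_mult integral) simp
    show "of_int (?B i) = (real ?p ^ f - 1) * real_of_rat (beta ! i)"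
      unfolding N using i len by (intro of_int_qbar_mult integral) simp
  qed
  also have "(real ?p - 1) * (real f * real l + \<dots>) \<ge> 0"
  proof -
    have "(\<Sum>j<f. Lambda_fn (map (\<lambda>x. of_int (int ?p ^ j * k) * x) alpha) (map (\<lambda>x. of_int (int ?p ^ j * k) * x) beta)
      (real ?p ^ j * of_int k * of_int m / (real ?p ^ f - 1))) \<ge> (\<Sum>j<f. - real l)"
    proof (intro sum_mono Lam)
      fix j
      \<comment> \<open>Both \<open>p ^ j\<close> and \<open>k\<close> are prime to
        \<open>q - 1\<close>, of which the common denominator is a divisor; so
        \<open>p ^ j * k\<close> is among the multipliers over which \<open>lambda_exp\<close>
        minimises.\<close>
      have "coprime (CARD('a) - 1) CARD('a)"
        using card_gt_1 by (metis coprime_diff_one_left_nat gr_implies_not0 not_gr_zero)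
      then have "coprime (CARD('a) - 1) (?p ^ j)" using f0 by (simp add: f coprime_power_right_iff)
      then have "coprime (int (?p ^ j)) (int (CARD('a) - 1))" by (simp only: coprime_int_iff coprime_commute)
      then have "coprime (int ?p ^ j * k) (int (CARD('a) - 1))" using k by (simp only: of_nat_power coprime_mult_left_iff)
      moreover have "int (common_denom (alpha @ beta)) dvd int (CARD('a) - 1)"
        using common_denom_dvd[of "alpha @ beta" "CARD('a) - 1"] integral by (simp only: int_dvd_int_iff)
      ultimately show "coprime (int ?p ^ j * k) (int (common_denom (alpha @ beta)))"
        by (metis coprime_divisors dvd_refl)
    qed
    then show ?thesis using p1 by (intro mult_nonneg_nonneg) auto
  qed
  finally have "Q \<le> P" by simp
  define u where "u a = g a / w ^ n a" for a
  have g: "g a = u a * w ^ n a" for a using w(1) by (simp add: u_def)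
  have u: "unit (u a)" for a using gn by (simp add: u_def)
  have "hypergeom_term alpha beta m =
      (\<Prod>i<?d. (u (m + ?A i) * u (- m - ?B i) / (u (?A i) * u (- ?B i)))
        * (w ^ (n (m + ?A i) + n (- m - ?B i)) / w ^ (n (?A i) + n (- ?B i))))"
    unfolding g by (intro prod.cong refl) (simp add: power_add mult_ac)
  also have "\<dots> = (\<Prod>i<?d. u (m + ?A i) * u (- m - ?B i) / (u (?A i) * u (- ?B i)))
        * (w ^ (\<Sum>i<?d. n (m + ?A i) + n (- m - ?B i)) / w ^ Q)"
    by (simp only: prod.distrib prod_dividef power_sum Q_def)
  finally have T: "hypergeom_term alpha beta m = (\<Prod>i<?d. u (m + ?A i) * u (- m - ?B i) / (u (?A i) * u (- ?B i)))
        * (w ^ (\<Sum>i<?d. n (m + ?A i) + n (- m - ?B i)) / w ^ Q)" .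
  have "of_nat CARD('a) = w ^ ((?p - 1) * f) / e" using e unitD(1) by simp
  then have q: "of_nat CARD('a) ^ l = w ^ ((?p - 1) * f * l) * inverse e ^ l"
    by (simp add: power_divide power_mult divide_inverse power_mult_distrib)
  have "of_nat CARD('a) ^ l * hypergeom_term alpha beta m =
      inverse e ^ l * (\<Prod>i<?d. u (m + ?A i) * u (- m - ?B i) / (u (?A i) * u (- ?B i))) * (w ^ P / w ^ Q)"
    unfolding q T P_def power_add by (simp only: times_divide_eq_right times_divide_eq_left mult_ac)
  also have "w ^ P / w ^ Q = w ^ (P - Q)" using \<open>Q \<le> P\<close> w(1) by (simp add: power_diff)
  also have "inverse e ^ l * (\<Prod>i<?d. u (m + ?A i) * u (- m - ?B i) / (u (?A i) * u (- ?B i))) * w ^ (P - Q) \<in> V"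
    by (intro mult_mem power_mem w(2) unitD(3)[OF e(1)] prod_mem unitD(2) unit_mult unit_divide u)
  finally show ?thesis .
qed

lemma hypergeom_Hq_mem:
  assumes len: "length beta = length alpha"
    and integral: "\<And>a. a \<in> set (alpha @ beta) \<Longrightarrow> of_nat (CARD('a) - 1) * a \<in> \<int>"
    and Lam: "\<And>k x. coprime k (int (common_denom (alpha @ beta))) \<Longrightarrow>
      Lambda_fn (map (\<lambda>a. of_int k * a) alpha) (map (\<lambda>a. of_int k * a) beta) x \<ge> - real l"
    and t: "t \<noteq> 0"
  shows "of_nat CARD('a) ^ l * hypergeom_Hq \<omega> \<psi> alpha beta t \<in> V"
proof (cases "unit (of_nat CHAR('a))")
  case True
  then show ?thesis using t by (intro mult_mem power_mem of_nat_mem hypergeom_Hq_mem_of_unit)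
next
  case False
  then have p: "of_nat CHAR('a) \<in> max_ideal" using unit_iff of_nat_mem by blast
  let ?s = "(-1) ^ length alpha * t"
  have "?s \<noteq> 0" using t by simp
  then have s: "\<omega> ?s \<in> V" using unit_omega unitD(2) by blast
  have "of_nat (CARD('a) - 1) = - (1 - of_nat CARD('a) :: complex)" using card_gt_1 by (simp add: of_nat_diff)
  then have "unit (1 - of_nat CARD('a))" using unit_uminus[OF unit_card_minus_1[OF p]] by simp
  then have inv: "1 / (1 - of_nat CARD('a)) \<in> V" using unit_inverse unitD(2) by (simp add: divide_inverse unitD(3))
  have "of_nat CARD('a) ^ l * hypergeom_Hq \<omega> \<psi> alpha beta t =
    1 / (1 - of_nat CARD('a)) * (\<Sum>m<CARD('a) - 1. of_nat CARD('a) ^ l * hypergeom_term alpha beta (int m) * \<omega> ?s ^ m)"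
    unfolding hypergeom_Hq_def Let_def by (simp only: sum_distrib_left mult_ac)
  also have "\<dots> \<in> V"
    by (intro mult_mem[OF inv] sum_mem mult_mem[OF hypergeom_term_mem power_mem[OF s]] p len integral Lam)
  finally show ?thesis .
qed

end

theorem mainTheorem6:
  fixes alpha beta :: "rat list"
    and \<psi> \<omega> :: "'a::{field,finite} \<Rightarrow> complex"
    and t :: 'a
  assumes len: "length beta = length alpha"
    and disj: "\<forall>i<length alpha. \<forall>j<length alpha. alpha ! i - beta ! j \<notin> \<int>"
    and integral: "\<forall>a\<in>set (alpha @ beta). of_nat (CARD('a) - 1) * a \<in> \<int>"
    and psi_hom: "\<forall>x y. \<psi> (x + y) = \<psi> x * \<psi> y"
    and psi_nz: "\<forall>x. \<psi> x \<noteq> 0"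
    and psi_nontriv: "\<exists>x. \<psi> x \<noteq> 1"
    and omega_hom: "\<forall>x y. x \<noteq> 0 \<longrightarrow> y \<noteq> 0 \<longrightarrow> \<omega> (x * y) = \<omega> x * \<omega> y"
    and omega_nz: "\<forall>x. x \<noteq> 0 \<longrightarrow> \<omega> x \<noteq> 0"
    and omega_gen: "\<forall>k::nat. (\<forall>x. x \<noteq> 0 \<longrightarrow> \<omega> x ^ k = 1) \<longleftrightarrow> (CARD('a) - 1) dvd k"
    and t_nz: "t \<noteq> 0"
  shows "algebraic_int
           (of_real (real CARD('a) powr lambda_exp alpha beta (common_denom (alpha @ beta)))
            * hypergeom_Hq \<omega> \<psi> alpha beta t)"
proof -
  interpret gauss_chars \<psi> \<omega>
    using psi_hom psi_nz psi_nontriv omega_hom omega_nz omega_gen by unfold_locales auto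
  obtain l where l: "lambda_exp alpha beta (common_denom (alpha @ beta)) = real l"
    and Lam: "\<And>k x. coprime k (int (common_denom (alpha @ beta))) \<Longrightarrow>
      Lambda_fn (map (\<lambda>a. of_int k * a) alpha) (map (\<lambda>a. of_int k * a) beta) x \<ge> - real l"
    using lambda_exp_properties by blast
  have "of_real (real CARD('a) powr lambda_exp alpha beta (common_denom (alpha @ beta))) = (of_nat CARD('a) ^ l :: complex)"
    unfolding l by (simp add: powr_realpow)
  moreover have "of_nat CARD('a) ^ l * hypergeom_Hq \<omega> \<psi> alpha beta t \<in> V" if "valuation_ring V" for V
  proof -
    interpret valuation_ring V by fact
    interpret gauss_chars_valuation \<psi> \<omega> V ..
    show ?thesis using integral by (intro hypergeom_Hq_mem len Lam t_nz) auto
  qed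
  ultimately show ?thesis by (simp only: algebraic_int_if_mem_valuation_rings)
qed

end
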